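(* Let $k \ge 3$, $a>0$ and $D\ge 1$, and suppose that for each $n$, $\mathcal{H}=\mathcal{H}_n$ is a $k$-uniform hypergraph satisfying $v(\mathcal{H})\le Dn$, $e(\mathcal{H})\ge an^2$ and $\Delta_2(\mathcal{H})\le D$. Let $X=e(\mathcal{H}_p)$ and $\mu=\mathbb{E} X$. There are $n_0,b,B>0$ (depending only on $k,a,D$) such that for all $n\ge n_0$, $p\in(0,1]$ and $\varepsilon>0$ we have, with $c(\varepsilon)=b\min\{\varepsilon^3,\varepsilon^{1/2}\}$, \[ \Pr(X \ge (1+\varepsilon)\mu) \le \exp\Bigl(-c(\varepsilon)\min\bigl\{\mu,\ \sqrt{\mu}\log(e/p)\bigr\}\Bigr). \] If, in addition, $\mathfrak{X}(\mathcal{H},D,(1+\varepsilon)\mu)$ and $(1+\varepsilon)\mu\ge 1$ hold, then, with $C(\varepsilon)=B\max\{1,\varepsilon^2\}$, \[ \Pr(X \ge (1+\varepsilon)\mu) \ge \exp\Bigl(-C(\varepsilon)\min\bigl\{\mu,\ \sqrt{\mu}\log(1/p)\bigr\}\Bigr). \]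
   Context: For a hypergraph $\mathcal{H}$, $V_p(\mathcal{H})$ is the random subset of $V(\mathcal{H})$ containing each vertex independently with probability $p$, and $\mathcal{H}_p=\mathcal{H}[V_p(\mathcal{H})]$ is the induced subhypergraph; $e(\cdot)$ and $v(\cdot)$ denote the numbers of edges and vertices. $\Delta_j(\mathcal{H})=\max_{S\subseteq V(\mathcal{H}),|S|=j}|\{f\in\mathcal{H}: S\subseteq f\}|$. The property $\mathfrak{X}(\mathcal{H},D,x)$ means: there exists $W\subseteq V(\mathcal{H})$ with $|W|\le D\max\{\sqrt{x},1\}$ and $e(\mathcal{H}[W])\ge x$. $\log$ is the natural logarithm. *)

theory Defs
  imports "HOL-Probability.Probability"
begin

text \<open>A hypergraph is a pair of a finite vertex set and a set of edges, each edge being a set of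
  vertices (so there are no repeated edges).\<close>

type_synonym 'v hypergraph = "'v set \<times> 'v set set"

definition hverts :: "'v hypergraph \<Rightarrow> 'v set" where
  "hverts H = fst H"

definition hedges :: "'v hypergraph \<Rightarrow> 'v set set" where
  "hedges H = snd H"

definition hypergraph :: "'v hypergraph \<Rightarrow> bool" where
  "hypergraph H \<longleftrightarrow> finite (hverts H) \<and> (\<forall>f\<in>hedges H. f \<subseteq> hverts H)"

definition uniform_hypergraph :: "nat \<Rightarrow> 'v hypergraph \<Rightarrow> bool" where
  "uniform_hypergraph k H \<longleftrightarrow> hypergraph H \<and> (\<forall>f\<in>hedges H. card f = k)"

definition num_verts :: "'v hypergraph \<Rightarrow> nat" where
  "num_verts H = card (hverts H)"

definition num_edges :: "'v hypergraph \<Rightarrow> nat" where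
  "num_edges H = card (hedges H)"

text \<open>The maximum below is over a nonempty set only if \<open>H\<close> has at least \<open>j\<close> vertices;
  otherwise its value is unspecified.\<close>

definition max_codegree :: "nat \<Rightarrow> 'v hypergraph \<Rightarrow> nat" where
  "max_codegree j H =
     Max ((\<lambda>S. card {f \<in> hedges H. S \<subseteq> f}) ` {S. S \<subseteq> hverts H \<and> card S = j})"

definition induced_subhypergraph :: "'v hypergraph \<Rightarrow> 'v set \<Rightarrow> 'v hypergraph" where
  "induced_subhypergraph H W = (hverts H \<inter> W, {f \<in> hedges H. f \<subseteq> W})"

definition random_vertex_set :: "'v hypergraph \<Rightarrow> real \<Rightarrow> 'v set pmf" where
  "random_vertex_set H p =
     map_pmf (\<lambda>\<omega>. {v \<in> hverts H. \<omega> v}) (Pi_pmf (hverts H) False (\<lambda>_. bernoulli_pmf p))"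

definition random_subhypergraph :: "'v hypergraph \<Rightarrow> real \<Rightarrow> 'v hypergraph pmf" where
  "random_subhypergraph H p = map_pmf (induced_subhypergraph H) (random_vertex_set H p)"

definition expected_edges :: "'v hypergraph \<Rightarrow> real \<Rightarrow> real" where
  "expected_edges H p =
     measure_pmf.expectation (random_subhypergraph H p) (\<lambda>G. real (num_edges G))"

text \<open>The property \<open>\<XX>(H, D, x)\<close>: some small vertex set spans at least \<open>x\<close> edges.\<close>

definition small_dense_set :: "'v hypergraph \<Rightarrow> real \<Rightarrow> real \<Rightarrow> bool" where
  "small_dense_set H D x \<longleftrightarrow>
     (\<exists>W\<subseteq>hverts H. real (card W) \<le> D * max (sqrt x) 1
        \<and> real (num_edges (induced_subhypergraph H W)) \<ge> x)"

end

theory Submission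
  imports Defs "HOL-Real_Asymp.Real_Asymp"
begin

text \<open>
  Upper bound. Put \<open>L = ln (e / p)\<close> and \<open>q\<close> of order \<open>1 + sqrt (max 1 \<epsilon> * \<mu>) / L\<close>. Starting from the
  empty set \<open>U\<close>, repeatedly look in the random set for a vertex with \<open>q\<close> spanned edges that are
  disjoint apart from this vertex and meet \<open>U\<close> at most once, and add them to \<open>U\<close>. Since
  \<open>k \<ge> 3\<close>, a union bound over all sequences shows that a step succeeds with probability at most
  \<open>exp (- q * L / 8)\<close>, so that \<open>U\<close> is unlikely to reach size of order \<open>sqrt (\<epsilon> * \<mu>)\<close>. If the process
  gets stuck before that, the at most \<open>D * card U ^ 2 \<le> \<epsilon> * \<mu> / 2\<close> edges meeting \<open>U\<close> twice can be
  discarded, and the remaining spanned edges have maximum degree \<open>O(q)\<close>. Such a subhypergraph with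
  at least \<open>(1 + \<epsilon> / 2) * \<mu>\<close> edges contains many sequences of disjoint edges, whose
  expected number is small.

  Lower bound. The set \<open>W\<close> gives \<open>p ^ card W\<close>. For smaller \<open>\<mu>\<close> one sums, over almost all sets \<open>A\<close>
  of \<open>m\<close> edges with \<open>m\<close> slightly above \<open>(1 + \<epsilon>) * \<mu>\<close>, the probability that exactly the edges in \<open>A\<close> are
  spanned; by a Harris-type inequality each is at least \<open>p ^ (k * m) * exp (- O(\<mu> + 1))\<close>.
\<close>

section \<open>Random vertex sets\<close>

text \<open>Repeats \<open>random_vertex_set\<close> with a bare vertex set in place of the
  hypergraph, so that an induction can add one vertex at a time without touching the edges.\<close>

definition random_set :: "'v set \<Rightarrow> real \<Rightarrow> 'v set pmf" where
  "random_set V p = map_pmf (\<lambda>\<omega>. {v \<in> V. \<omega> v}) (Pi_pmf V False (\<lambda>_. bernoulli_pmf p))"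

abbreviation rprob :: "'v set \<Rightarrow> real \<Rightarrow> ('v set \<Rightarrow> bool) \<Rightarrow> real" where
  "rprob V p P \<equiv> measure_pmf.prob (random_set V p) {S. P S}"

lemma set_random_set: "S \<in> set_pmf (random_set V p) \<Longrightarrow> S \<subseteq> V"
  by (auto simp: random_set_def)

lemma finite_set_random_set: "finite V \<Longrightarrow> finite (set_pmf (random_set V p))"
  by (rule finite_subset[of _ "Pow V"]) (auto dest: set_random_set)

lemma integrable_random_set:
  fixes f :: "'v set \<Rightarrow> real"
  shows "finite V \<Longrightarrow> integrable (measure_pmf (random_set V p)) f"
  by (simp add: integrable_measure_pmf_finite finite_set_random_set)

lemma random_set_empty: "random_set {} p = return_pmf {}"
  by (simp add: random_set_def)

lemma random_set_insert:
  assumes "finite V" "v \<notin> V"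
  shows "random_set (insert v V) p =
    bind_pmf (bernoulli_pmf p) (\<lambda>b. map_pmf (\<lambda>S. if b then insert v S else S) (random_set V p))"
proof -
  have *: "{u. (u = v \<or> u \<in> V) \<and> (u \<noteq> v \<longrightarrow> \<omega> u) \<and> (u = v \<longrightarrow> b)} =
      (if b then insert v {u \<in> V. \<omega> u} else {u \<in> V. \<omega> u})" for \<omega> b
    using assms by auto
  show ?thesis
    using assms
    by (simp add: random_set_def Pi_pmf_insert' map_bind_pmf map_pmf_comp)
      (auto simp: map_pmf_def fun_upd_def * intro!: bind_pmf_cong)
qed

text \<open>Conditioning on whether \<open>v\<close> is chosen. The inductions over \<open>V\<close>
  in \<open>rprob_subset\<close> and \<open>rprob_avoid_ge\<close> rest on this recursion.\<close>

lemma rprob_insert: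
  assumes "finite V" "v \<notin> V" "0 \<le> p" "p \<le> 1"
  shows "rprob (insert v V) p P = p * rprob V p (\<lambda>S. P (insert v S)) + (1 - p) * rprob V p P"
proof -
  have "ennreal (rprob (insert v V) p P) =
      ennreal (p * rprob V p (\<lambda>S. P (insert v S)) + (1 - p) * rprob V p P)"
    using assms
    by (simp add: random_set_insert flip: measure_pmf.emeasure_eq_measure)
      (simp add: nn_integral_measure_pmf_finite UNIV_bool measure_pmf.emeasure_eq_measure
         vimage_def mult.commute flip: ennreal_mult ennreal_plus)
  then show ?thesis
    using assms by (subst (asm) ennreal_inj) auto
qed

lemma rprob_mono:
  assumes "\<And>S. S \<subseteq> V \<Longrightarrow> P S \<Longrightarrow> Q S"
  shows "rprob V p P \<le> rprob V p Q"
  by (intro measure_pmf.finite_measure_mono_AE)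
    (auto simp: AE_measure_pmf_iff dest!: set_random_set intro: assms)

lemma rprob_subset:
  assumes "finite V" "W \<subseteq> V" "0 \<le> p" "p \<le> 1"
  shows "rprob V p (\<lambda>S. W \<subseteq> S) = p ^ card W"
  using assms(1,2)
proof (induction V arbitrary: W rule: finite_induct)
  case empty
  then show ?case by (simp add: random_set_empty indicator_def)
next
  case (insert v V)
  have fW: "finite W" using insert finite_subset by blast
  show ?case
  proof (cases "v \<in> W")
    case True
    \<comment> \<open>A sample of \<open>V\<close> never contains \<open>v\<close>, so the branch
      without \<open>v\<close> contributes nothing.\<close>
    have "rprob V p (\<lambda>S. W \<subseteq> S) \<le> rprob V p (\<lambda>S. False)"
      using True insert by (intro rprob_mono) auto
    then have 0: "rprob V p (\<lambda>S. W \<subseteq> S) = 0" by (simp add: order.antisym)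
    have "W - {v} \<subseteq> V" using insert.prems by auto
    from insert.IH[OF this] show ?thesis
      using insert assms True fW 0
      by (simp add: rprob_insert subset_insert_iff flip: power_Suc)
         (metis Suc_pred card_gt_0_iff empty_iff power_Suc)
  next
    case False
    then have "W \<subseteq> V" using insert.prems by auto
    from insert.IH[OF this] False show ?thesis
      using insert assms by (simp add: rprob_insert subset_insert algebra_simps)
  qed
qed

text \<open>As a function of \<open>p\<close>, a product of nonnegative decreasing affine factors is
  convex on the unit interval, so it lies below the chord between \<open>p = 0\<close> and
  \<open>p = 1\<close>. The slack gained in an induction step is
  \<open>p * (1 - p) * x i * (1 - ?A)\<close>.\<close>

lemma prod_one_minus_convex:
  fixes x :: "'i \<Rightarrow> real"
  assumes "finite I" "\<And>i. i \<in> I \<Longrightarrow> 0 \<le> x i \<and> x i \<le> 1" "0 \<le> p" "p \<le> 1"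
  shows "(\<Prod>i\<in>I. 1 - p * x i) \<le> p * (\<Prod>i\<in>I. 1 - x i) + (1 - p)"
  using assms(1,2)
proof (induction I rule: finite_induct)
  case empty
  then show ?case by simp
next
  case (insert i I)
  let ?A = "\<Prod>i\<in>I. 1 - x i"
  have A: "0 \<le> ?A" "?A \<le> 1" using insert by (auto intro!: prod_nonneg prod_le_1)
  have x: "0 \<le> x i" "x i \<le> 1" using insert by auto
  have "(\<Prod>i\<in>insert i I. 1 - p * x i) = (1 - p * x i) * (\<Prod>i\<in>I. 1 - p * x i)"
    using insert by simp
  also have "\<dots> \<le> (1 - p * x i) * (p * ?A + (1 - p))"
    using insert x assms by (intro mult_left_mono) (auto intro: mult_le_one)
  also have "\<dots> = p * ((1 - x i) * ?A) + (1 - p) - p * (1 - p) * x i * (1 - ?A)"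
    by algebra
  also have "\<dots> \<le> p * ((1 - x i) * ?A) + (1 - p)"
    using A x assms by simp
  finally show ?case using insert by simp
qed

text \<open>An instance of Harris' inequality, in which the induction only needs convexity.\<close>

lemma rprob_avoid_ge:
  fixes F :: "'i \<Rightarrow> 'v set"
  assumes "finite V" "finite I" "W \<subseteq> V" "\<And>i. i \<in> I \<Longrightarrow> F i \<subseteq> V" "0 \<le> p" "p \<le> 1"
  shows "rprob V p (\<lambda>S. W \<subseteq> S \<and> (\<forall>i\<in>I. \<not> F i \<subseteq> S)) \<ge> p ^ card W * (\<Prod>i\<in>I. 1 - p ^ card (F i - W))"
  using assms(1-4)
proof (induction V arbitrary: W I F rule: finite_induct)
  case empty
  have F: "F i = {}" if "i \<in> I" for i using empty.prems(3)[OF that] by simp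
  show ?case
  proof (cases "I = {}")
    case True
    then show ?thesis using empty by (simp add: random_set_empty indicator_def)
  next
    case False
    then have "card I > 0" using empty by (simp add: card_gt_0_iff)
    \<comment> \<open>Every \<open>F i\<close> is empty here, so each factor is
      \<open>1 - p ^ 0 = 0\<close> and the bound is trivial.\<close>
    have "(\<Prod>i\<in>I. 1 - p ^ card (F i - W)) = (\<Prod>i\<in>I. 0)"
      using F by (intro prod.cong) auto
    also have "\<dots> = 0" using \<open>card I > 0\<close> by simp
    finally show ?thesis by simp
  qed
next
  case (insert v V)
  have fW: "finite W" using insert.prems(2) insert.hyps(1) finite_subset by blast
  have fF: "finite (F i)" if "i \<in> I" for i
    using insert.prems(3)[OF that] insert.hyps finite_subset by blast
  have pw: "p ^ j \<le> 1" "0 \<le> p ^ j" for j using assms by (auto intro: power_le_one)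
  let ?ev = "\<lambda>W F I S. W \<subseteq> S \<and> (\<forall>i\<in>I. \<not> F i \<subseteq> S)"
  let ?rhs = "\<lambda>W F I. p ^ card W * (\<Prod>i\<in>I. 1 - p ^ card (F i - W))"
  let ?F = "\<lambda>i. F i - {v}"
  have sub: "(\<lambda>S. ?ev W F I (insert v S)) = ?ev (W - {v}) ?F I"
    by (auto simp: fun_eq_iff subset_insert_iff)
  have IH1: "rprob V p (?ev (W - {v}) ?F I) \<ge> ?rhs (W - {v}) ?F I"
    using insert.prems by (intro insert.IH) auto
  show ?case
  proof (cases "v \<in> W")
    case True
    have "F i - {v} - (W - {v}) = F i - W" for i using True by auto
    then have "?rhs W F I = p * ?rhs (W - {v}) ?F I"
      using True fW by (simp add: card_Diff_singleton flip: power_Suc)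
        (metis Suc_pred card_gt_0_iff empty_iff mult.assoc power_Suc)
    also have "\<dots> \<le> p * rprob V p (?ev (W - {v}) ?F I)"
      using IH1 assms by (intro mult_left_mono) auto
    also have "\<dots> \<le> rprob (insert v V) p (?ev W F I)"
      unfolding rprob_insert[OF insert.hyps assms(5,6)] sub using assms by simp
    finally show ?thesis .
  next
    case False
    \<comment> \<open>If \<open>v\<close> is absent, the sets in \<open>I1\<close> are avoided for
      free; if it is present, they lose the element \<open>v\<close>. The factors from
      \<open>I0\<close> agree in both branches, so only the product over \<open>I1\<close> has to be
      compared, and this is where convexity enters.\<close>
    define I0 where "I0 = {i\<in>I. v \<notin> F i}"
    define I1 where "I1 = {i\<in>I. v \<in> F i}"
    have I: "I = I0 \<union> I1" "I0 \<inter> I1 = {}" "finite I0" "finite I1"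
      using insert.prems by (auto simp: I0_def I1_def)
    have WV: "W \<subseteq> V" using False insert.prems by auto
    have IH0: "rprob V p (?ev W F I0) \<ge> ?rhs W F I0"
      using insert.prems WV by (intro insert.IH) (auto simp: I0_def)
    have "rprob V p (?ev W F I0) \<le> rprob V p (?ev W F I)"
      by (rule rprob_mono) (use insert.hyps in \<open>auto simp: I0_def\<close>)
    with IH0 have IH0': "rprob V p (?ev W F I) \<ge> ?rhs W F I0" by simp
    let ?x = "\<lambda>i. p ^ card (F i - {v} - W)"
    let ?Q = "\<Prod>i\<in>I0. 1 - p ^ card (F i - W)"
    have "?rhs (W - {v}) ?F I = p ^ card W * (?Q * (\<Prod>i\<in>I1. 1 - ?x i))"
      using False I by (simp add: prod.union_disjoint) (auto simp: I0_def intro!: disjI2 prod.cong)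
    with IH1 have IH1': "rprob V p (?ev (W - {v}) ?F I) \<ge> p ^ card W * (?Q * (\<Prod>i\<in>I1. 1 - ?x i))"
      by simp
    have eq: "p ^ card (F i - W) = p * ?x i" if "i \<in> I1" for i
    proof -
      have "F i - W = insert v (F i - {v} - W)" using that False by (auto simp: I1_def)
      moreover have "finite (F i - {v} - W)" using that fF by (auto simp: I1_def)
      ultimately show ?thesis by (metis DiffD1 DiffD2 card_insert_disjoint insertI1 power_Suc)
    qed
    have Q: "?Q \<ge> 0" using pw by (auto intro!: prod_nonneg)
    have "?rhs W F I = p ^ card W * ?Q * (\<Prod>i\<in>I1. 1 - p * ?x i)"
      using I eq by (simp add: prod.union_disjoint)
    also have "\<dots> \<le> p ^ card W * ?Q * (p * (\<Prod>i\<in>I1. 1 - ?x i) + (1 - p))"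
      using Q I pw assms by (intro mult_left_mono prod_one_minus_convex) auto
    also have "\<dots> = p * (p ^ card W * (?Q * (\<Prod>i\<in>I1. 1 - ?x i))) + (1 - p) * (p ^ card W * ?Q)"
      by (simp add: algebra_simps)
    also have "\<dots> \<le> p * rprob V p (?ev (W - {v}) ?F I) + (1 - p) * rprob V p (?ev W F I)"
      using IH1' IH0' assms by (intro add_mono mult_left_mono) auto
    also have "\<dots> = rprob (insert v V) p (?ev W F I)"
      unfolding rprob_insert[OF insert.hyps assms(5,6)] sub ..
    finally show ?thesis .
  qed
qed

section \<open>Union bounds and Markov's inequality\<close>

lemma rprob_expectation:
  "rprob V p P = measure_pmf.expectation (random_set V p) (\<lambda>S. of_bool (P S))"
proof -
  have "(\<lambda>S. of_bool (P S)) = (indicator {S. P S} :: _ \<Rightarrow> real)" by (auto simp: indicator_def)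
  then show ?thesis by simp
qed

lemma rprob_UN:
  assumes "finite I" "\<And>S. S \<subseteq> V \<Longrightarrow> P S \<Longrightarrow> \<exists>i\<in>I. Q i S"
  shows "rprob V p P \<le> (\<Sum>i\<in>I. rprob V p (Q i))"
proof -
  have "rprob V p P \<le> rprob V p (\<lambda>S. \<exists>i\<in>I. Q i S)"
    using assms(2) by (intro rprob_mono) auto
  also have "{S. \<exists>i\<in>I. Q i S} = (\<Union>i\<in>I. {S. Q i S})" by auto
  also have "measure_pmf.prob (random_set V p) \<dots> \<le> (\<Sum>i\<in>I. rprob V p (Q i))"
    by (intro measure_pmf.finite_measure_subadditive_finite) (use assms in auto)
  finally show ?thesis .
qed

lemma rprob_disj:
  assumes "\<And>S. S \<subseteq> V \<Longrightarrow> P S \<Longrightarrow> Q S \<or> R S"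
  shows "rprob V p P \<le> rprob V p Q + rprob V p R"
proof -
  have "rprob V p P \<le> rprob V p (\<lambda>S. Q S \<or> R S)"
    using assms by (rule rprob_mono)
  also have "{S. Q S \<or> R S} = {S. Q S} \<union> {S. R S}" by auto
  also have "measure_pmf.prob (random_set V p) \<dots> \<le> rprob V p Q + rprob V p R"
    by (rule measure_Un_le) auto
  finally show ?thesis .
qed

lemma rprob_Markov:
  assumes "finite V" "c > 0" "\<And>S. S \<subseteq> V \<Longrightarrow> f S \<ge> 0" "\<And>S. S \<subseteq> V \<Longrightarrow> P S \<Longrightarrow> f S \<ge> c"
  shows "rprob V p P \<le> measure_pmf.expectation (random_set V p) f / c"
proof -
  have "c * rprob V p P = measure_pmf.expectation (random_set V p) (\<lambda>S. c * of_bool (P S))"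
    by (simp add: rprob_expectation)
  also have "\<dots> \<le> measure_pmf.expectation (random_set V p) f"
    using assms
    by (intro integral_mono_AE integrable_random_set) (auto simp: AE_measure_pmf_iff dest!: set_random_set)
  finally show ?thesis using assms(2) by (simp add: field_simps)
qed

section \<open>Almost linear hypergraphs\<close>

lemma card_UN_bound:
  assumes "finite I" "A \<subseteq> (\<Union>i\<in>I. B i)" "\<And>i. i \<in> I \<Longrightarrow> finite (B i)"
    and "\<And>i. i \<in> I \<Longrightarrow> real (card (B i)) \<le> c"
  shows "real (card A) \<le> real (card I) * c"
proof -
  have "card A \<le> card (\<Union>i\<in>I. B i)"
    using assms by (intro card_mono) auto
  also have "\<dots> \<le> (\<Sum>i\<in>I. card (B i))" using assms(1) by (rule card_UN_le)
  finally have "real (card A) \<le> (\<Sum>i\<in>I. real (card (B i)))" by (simp flip: of_nat_sum)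
  also have "\<dots> \<le> real (card I) * c" using assms by (intro sum_bounded_above) auto
  finally show ?thesis .
qed

text \<open>A generating function bound for the elementary symmetric polynomial:
  \<open>s ^ q\<close> times the sum is at most the product of all \<open>1 + s * w i\<close>, hence
  at most \<open>exp (s * lam)\<close>. The choice \<open>s = q / lam\<close> minimises
  \<open>exp (s * lam) / s ^ q\<close>.\<close>

lemma sum_prod_subsets_le:
  fixes w :: "'i \<Rightarrow> real"
  assumes "finite A" "\<And>i. i \<in> A \<Longrightarrow> w i \<ge> 0" "sum w A \<le> lam" "lam > 0" "q > 0"
  shows "(\<Sum>F | F \<subseteq> A \<and> card F = q. prod w F) \<le> (exp 1 * lam / real q) ^ q"
proof -
  define s where "s = real q / lam"
  have s: "s > 0" using assms by (simp add: s_def)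
  have "s ^ q * (\<Sum>F | F \<subseteq> A \<and> card F = q. prod w F) = (\<Sum>F | F \<subseteq> A \<and> card F = q. \<Prod>i\<in>F. s * w i)"
    by (simp add: sum_distrib_left prod.distrib)
  also have "\<dots> \<le> (\<Sum>F\<in>Pow A. \<Prod>i\<in>F. s * w i)"
    using assms s by (intro sum_mono2) (auto intro!: prod_nonneg)
  also have "\<dots> = (\<Prod>i\<in>A. s * w i + 1)"
    using assms by (simp add: prod_add)
  also have "\<dots> \<le> (\<Prod>i\<in>A. exp (s * w i))"
    using assms s by (intro prod_mono) (auto simp: add.commute intro: exp_ge_add_one_self_aux)
  also have "\<dots> = exp (s * sum w A)"
    using assms by (simp add: exp_sum sum_distrib_left)
  also have "\<dots> \<le> exp (s * lam)" using assms s by simp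
  also have "\<dots> = exp 1 ^ q" using assms by (simp add: s_def flip: exp_of_nat_mult)
  finally have "(\<Sum>F | F \<subseteq> A \<and> card F = q. prod w F) \<le> exp 1 ^ q / s ^ q"
    using s by (simp add: field_simps)
  also have "\<dots> = (exp 1 * lam / real q) ^ q"
    using assms by (simp add: s_def power_divide power_mult_distrib)
  finally show ?thesis .
qed

text \<open>The codegree condition ranges over all pairs of distinct elements instead of using
  \<open>max_codegree\<close>, which has an unspecified value on fewer than two vertices.\<close>

locale almost_linear =
  fixes V :: "'v set" and E :: "'v set set" and k :: nat and D :: real
  assumes finite_V: "finite V"
    and edge_subset: "\<And>f. f \<in> E \<Longrightarrow> f \<subseteq> V"
    and edge_card: "\<And>f. f \<in> E \<Longrightarrow> card f = k"
    and k3: "k \<ge> 3"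
    and D1: "D \<ge> 1"
    and codegree: "\<And>u v. u \<noteq> v \<Longrightarrow> real (card {f \<in> E. u \<in> f \<and> v \<in> f}) \<le> D"
begin

lemma finite_E: "finite E"
  by (rule finite_subset[of _ "Pow V"]) (use finite_V edge_subset in auto)

lemma finite_edge: "f \<in> E \<Longrightarrow> finite f"
  using finite_V edge_subset finite_subset by blast

text \<open>An edge through \<open>v\<close> has a second vertex \<open>w\<close>, so the codegrees
  of \<open>v\<close> with all \<open>w\<close> can be summed.\<close>

lemma degree: "real (card {f \<in> E. v \<in> f}) \<le> real (card V) * D"
proof (rule card_UN_bound[OF finite_V, where B = "\<lambda>w. {f \<in> E. w \<noteq> v \<and> w \<in> f \<and> v \<in> f}"])
  show "{f \<in> E. v \<in> f} \<subseteq> (\<Union>w\<in>V. {f \<in> E. w \<noteq> v \<and> w \<in> f \<and> v \<in> f})"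
  proof
    fix f assume f: "f \<in> {f \<in> E. v \<in> f}"
    then have "\<not> f \<subseteq> {v}" using edge_card[of f] k3 card_mono[of "{v}" f] by fastforce
    then obtain w where "w \<in> f" "w \<noteq> v" by blast
    with f edge_subset[of f] show "f \<in> (\<Union>w\<in>V. {f \<in> E. w \<noteq> v \<and> w \<in> f \<and> v \<in> f})"
      by blast
  qed
  show "real (card {f \<in> E. w \<noteq> v \<and> w \<in> f \<and> v \<in> f}) \<le> D" for w
    using codegree[of w v] D1 by (cases "w = v") auto
qed (use finite_E in auto)

text \<open>Each such edge contains a pair of distinct vertices of \<open>U\<close>. Ordered pairs
  are used, and the diagonal of \<open>U \<times> U\<close> contributes empty sets.\<close>

lemma edges_meeting_twice:
  assumes "finite U"
  shows "real (card {f \<in> E. card (f \<inter> U) \<ge> 2}) \<le> (real (card U))\<^sup>2 * D"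
proof -
  have "real (card {f \<in> E. card (f \<inter> U) \<ge> 2}) \<le> real (card (U \<times> U)) * D"
  proof (rule card_UN_bound[where B = "\<lambda>x. {f \<in> E. fst x \<noteq> snd x \<and> fst x \<in> f \<and> snd x \<in> f}"])
    show "{f \<in> E. card (f \<inter> U) \<ge> 2} \<subseteq> (\<Union>x\<in>U \<times> U. {f \<in> E. fst x \<noteq> snd x \<and> fst x \<in> f \<and> snd x \<in> f})"
    proof
      fix f assume f: "f \<in> {f \<in> E. card (f \<inter> U) \<ge> 2}"
      then have "2 \<le> card (f \<inter> U)" by simp
      then obtain T where "T \<subseteq> f \<inter> U" "card T = 2" by (rule obtain_subset_with_card_n)
      then obtain x y where "x \<noteq> y" "x \<in> f \<inter> U" "y \<in> f \<inter> U" by (auto simp: card_2_iff)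
      with f show "f \<in> (\<Union>x\<in>U \<times> U. {f \<in> E. fst x \<noteq> snd x \<and> fst x \<in> f \<and> snd x \<in> f})"
        by (intro UN_I[of "(x, y)"]) auto
    qed
    show "real (card {f \<in> E. fst x \<noteq> snd x \<and> fst x \<in> f \<and> snd x \<in> f}) \<le> D" for x
      using codegree[of "fst x" "snd x"] D1 by (cases "fst x = snd x") auto
  qed (use assms finite_E in auto)
  then show ?thesis by (simp add: card_cartesian_product power2_eq_square)
qed

text \<open>Greedy choice: at most \<open>k * D\<close> edges through \<open>v\<close> meet a chosen
  edge \<open>f\<close> in a further vertex, \<open>f\<close> itself included, so each choice costs
  at most \<open>k * D\<close> edges.\<close>

lemma star_matching:
  assumes "G \<subseteq> {f \<in> E. v \<in> f}" "real (card G) \<ge> real (q * k) * D"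
  shows "\<exists>F\<subseteq>G. card F = q \<and> pairwise (\<lambda>f g. f \<inter> g = {v}) F"
  using assms
proof (induction q arbitrary: G)
  case 0
  then show ?case by (intro exI[of _ "{}"]) auto
next
  case (Suc q)
  have finG: "finite G" using Suc.prems finite_E finite_subset by fastforce
  have "real (Suc q * k) > 0" using k3 by (subst of_nat_0_less_iff) simp
  then have "real (Suc q * k) * D > 0" using D1 by (intro mult_pos_pos) auto
  with Suc.prems(2) have "real (card G) > 0" by linarith
  then obtain f where f: "f \<in> G" by fastforce
  have fE: "f \<in> E" "v \<in> f" using f Suc.prems by auto
  define G' where "G' = {g \<in> G. f \<inter> g = {v}}"
  have "real (card (G - G')) \<le> real (card (f - {v})) * D"
  proof (rule card_UN_bound[where B = "\<lambda>w. {g \<in> E. w \<in> g \<and> v \<in> g}"])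
    show "G - G' \<subseteq> (\<Union>w\<in>f - {v}. {g \<in> E. w \<in> g \<and> v \<in> g})"
      using Suc.prems(1) fE by (auto simp: G'_def)
    show "real (card {g \<in> E. w \<in> g \<and> v \<in> g}) \<le> D" if "w \<in> f - {v}" for w
      using that by (intro codegree) auto
  qed (use finite_edge fE finite_E in auto)
  also have "\<dots> \<le> real k * D"
    using fE edge_card finite_edge D1 by (intro mult_right_mono) (auto simp: card_Diff_singleton)
  finally have "real (card G') \<ge> real (q * k) * D"
    using Suc.prems(2) card_Diff_subset[of G' G] finG card_mono[of G G']
    by (auto simp: G'_def algebra_simps of_nat_diff)
  then obtain F where F: "F \<subseteq> G'" "card F = q" "pairwise (\<lambda>f g. f \<inter> g = {v}) F"
    using Suc.IH[of G'] Suc.prems(1) by (auto simp: G'_def)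
  \<comment> \<open>Since \<open>f \<inter> f = f\<close> is not \<open>{v}\<close>, the edge
    \<open>f\<close> was itself removed from \<open>G'\<close> and cannot be chosen again.\<close>
  have "f \<noteq> {v}" using edge_card[OF fE(1)] k3 by auto
  then have "f \<notin> F" using F(1) by (auto simp: G'_def)
  moreover have "finite F" using F(1) finG by (auto simp: G'_def intro: finite_subset)
  moreover have "pairwise (\<lambda>f g. f \<inter> g = {v}) (insert f F)"
    using F(1,3) by (auto simp: pairwise_insert G'_def)
  ultimately show ?case
    using F f by (intro exI[of _ "insert f F"]) (auto simp: G'_def)
qed

subsection \<open>Subhypergraphs of small maximum degree\<close>

text \<open>The number of ordered sequences of \<open>m\<close> pairwise disjoint edges inside
  \<open>S\<close> that all avoid \<open>U\<close>.\<close>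

primrec dseq :: "nat \<Rightarrow> 'v set \<Rightarrow> 'v set \<Rightarrow> real" where
  "dseq 0 U S = 1"
| "dseq (Suc m) U S = (\<Sum>f | f \<in> E \<and> f \<subseteq> S \<and> f \<inter> U = {}. dseq m (U \<union> f) S)"

lemma dseq_nonneg: "dseq m U S \<ge> 0"
  by (induction m arbitrary: U) (auto intro!: sum_nonneg)

text \<open>Each further edge has at most \<open>card E\<close> choices and, being disjoint from
  everything before, costs exactly \<open>p ^ k\<close>. The indicator of
  \<open>U \<subseteq> S\<close> carries the edges already chosen through the induction.\<close>

lemma expectation_dseq:
  assumes "U \<subseteq> V" "0 \<le> p" "p \<le> 1"
  shows "measure_pmf.expectation (random_set V p) (\<lambda>S. of_bool (U \<subseteq> S) * dseq m U S)
    \<le> p ^ card U * (real (card E) * p ^ k) ^ m"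
  using assms(1)
proof (induction m arbitrary: U)
  case 0
  then show ?case
    using rprob_expectation[of V p "\<lambda>S. U \<subseteq> S"] rprob_subset[OF finite_V 0 assms(2,3)] by simp
next
  case (Suc m)
  let ?I = "{f \<in> E. f \<inter> U = {}}"
  let ?\<mu> = "real (card E) * p ^ k"
  have fin: "finite ?I" "finite U" using finite_E Suc.prems finite_V finite_subset by auto
  have "of_bool (U \<subseteq> S) * dseq (Suc m) U S = (\<Sum>f\<in>?I. of_bool (U \<union> f \<subseteq> S) * dseq m (U \<union> f) S)" for S
  proof -
    have "dseq (Suc m) U S = (\<Sum>f\<in>?I. of_bool (f \<subseteq> S) * dseq m (U \<union> f) S)"
      unfolding dseq.simps using finite_E
      by (intro sum.mono_neutral_cong_left) auto
    then show ?thesis by (auto simp: sum_distrib_left intro!: sum.cong)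
  qed
  then have "measure_pmf.expectation (random_set V p) (\<lambda>S. of_bool (U \<subseteq> S) * dseq (Suc m) U S)
    = (\<Sum>f\<in>?I. measure_pmf.expectation (random_set V p) (\<lambda>S. of_bool (U \<union> f \<subseteq> S) * dseq m (U \<union> f) S))"
    using integrable_random_set[OF finite_V] by (simp add: Bochner_Integration.integral_sum)
  also have "\<dots> \<le> (\<Sum>f\<in>?I. p ^ card U * (p ^ k * ?\<mu> ^ m))"
  proof (intro sum_mono)
    fix f assume f: "f \<in> ?I"
    then have "card (U \<union> f) = card U + k"
      using fin finite_edge edge_card by (subst card_Un_disjoint) auto
    then show "measure_pmf.expectation (random_set V p) (\<lambda>S. of_bool (U \<union> f \<subseteq> S) * dseq m (U \<union> f) S)
        \<le> p ^ card U * (p ^ k * ?\<mu> ^ m)"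
      using Suc.IH[of "U \<union> f"] f edge_subset Suc.prems by (auto simp: power_add mult.assoc)
  qed
  also have "\<dots> = real (card ?I) * (p ^ card U * (p ^ k * ?\<mu> ^ m))" by simp
  also have "\<dots> \<le> real (card E) * (p ^ card U * (p ^ k * ?\<mu> ^ m))"
    using finite_E assms by (intro mult_right_mono) (auto intro: card_mono)
  finally show ?case by (simp add: mult_ac)
qed

text \<open>At most \<open>card U * r\<close> edges of \<open>J\<close> meet \<open>U\<close>, and
  \<open>U\<close> grows by at most \<open>k\<close> per edge, so even the last of the
  \<open>m\<close> choices has \<open>z\<close> options in \<open>J\<close>. The guard
  \<open>m > 0\<close> spares the empty sequence the condition with \<open>m - 1\<close>.\<close>

lemma dseq_ge:
  assumes "J \<subseteq> {f \<in> E. f \<subseteq> S}" "\<And>v. real (card {f \<in> J. v \<in> f}) \<le> r" "finite U" "z \<ge> 0" "r \<ge> 0"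
    and "m > 0 \<Longrightarrow> real (card J) - (real (card U) + real k * (real m - 1)) * r \<ge> z"
  shows "dseq m U S \<ge> z ^ m"
  using assms(3,6)
proof (induction m arbitrary: U)
  case 0
  then show ?case by simp
next
  case (Suc m)
  have finJ: "finite J" using assms(1) finite_E by (auto intro: finite_subset)
  let ?I = "{f \<in> E. f \<subseteq> S \<and> f \<inter> U = {}}"
  have "real (card (J - {f \<in> J. f \<inter> U = {}})) \<le> real (card U) * r"
    by (rule card_UN_bound[of _ _ "\<lambda>u. {f \<in> J. u \<in> f}"]) (use Suc.prems finJ assms(2) in auto)
  then have "real (card J) - real (card {f \<in> J. f \<inter> U = {}}) \<le> real (card U) * r"
    using finJ card_mono[of J "{f \<in> J. f \<inter> U = {}}"] by (subst (asm) card_Diff_subset) auto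
  moreover have "real (card {f \<in> J. f \<inter> U = {}}) \<le> real (card ?I)"
    using finite_E assms(1) by (auto intro!: card_mono)
  moreover have "real k * real m * r \<ge> 0" using assms by simp
  ultimately have cI: "real (card ?I) \<ge> z"
    using Suc.prems(2) by (simp add: algebra_simps)
  have "z ^ Suc m \<le> real (card ?I) * z ^ m"
    using cI assms by (simp add: mult_right_mono)
  also have "\<dots> \<le> (\<Sum>f\<in>?I. dseq m (U \<union> f) S)"
  proof (rule sum_bounded_below)
    fix f assume f: "f \<in> ?I"
    then have c: "real (card (U \<union> f)) \<le> real (card U) + real k"
      using card_Un_le[of U f] edge_card by auto
    show "z ^ m \<le> dseq m (U \<union> f) S"
    proof (rule Suc.IH)
      show "finite (U \<union> f)" using Suc.prems f finite_edge by auto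
      assume "m > 0"
      have "(real (card (U \<union> f)) + real k * (real m - 1)) * r \<le> (real (card U) + real k * (real (Suc m) - 1)) * r"
        using c assms by (intro mult_right_mono) (auto simp: algebra_simps)
      then show "real (card J) - (real (card (U \<union> f)) + real k * (real m - 1)) * r \<ge> z"
        using Suc.prems(2) by simp
    qed
  qed
  finally show ?case by simp
qed

text \<open>Markov's inequality for the number of disjoint sequences: the event forces at least
  \<open>z ^ m\<close> of them, while the expected number is at most
  \<open>(card E * p ^ k) ^ m\<close>.\<close>

lemma bounded_degree_tail:
  assumes p: "0 \<le> p" "p \<le> 1" and z: "z > 0" and r: "r \<ge> 0" and m: "m > 0"
    and j: "j - real k * (real m - 1) * r \<ge> z"
  shows "rprob V p (\<lambda>S. \<exists>J\<subseteq>{f \<in> E. f \<subseteq> S}. real (card J) \<ge> j \<and> (\<forall>v. real (card {f \<in> J. v \<in> f}) \<le> r))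
    \<le> (real (card E) * p ^ k / z) ^ m"
proof -
  have "rprob V p (\<lambda>S. \<exists>J\<subseteq>{f \<in> E. f \<subseteq> S}. real (card J) \<ge> j \<and> (\<forall>v. real (card {f \<in> J. v \<in> f}) \<le> r))
      \<le> measure_pmf.expectation (random_set V p) (\<lambda>S. of_bool ({} \<subseteq> S) * dseq m {} S) / z ^ m"
  proof (rule rprob_Markov[OF finite_V])
    fix S assume "\<exists>J\<subseteq>{f \<in> E. f \<subseteq> S}. real (card J) \<ge> j \<and> (\<forall>v. real (card {f \<in> J. v \<in> f}) \<le> r)"
    then obtain J where "J \<subseteq> {f \<in> E. f \<subseteq> S}" "real (card J) \<ge> j" "\<And>v. real (card {f \<in> J. v \<in> f}) \<le> r"
      by blast
    then show "z ^ m \<le> of_bool ({} \<subseteq> S) * dseq m {} S"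
      using dseq_ge[of J S r "{}" z m] z r j by simp
  qed (use z dseq_nonneg in auto)
  also have "\<dots> \<le> (real (card E) * p ^ k) ^ m / z ^ m"
    using expectation_dseq[of "{}" p m] p z by (intro divide_right_mono) auto
  finally show ?thesis by (simp add: power_divide)
qed

end

context almost_linear
begin

subsection \<open>Chains of stars\<close>

text \<open>Sunflowers with \<open>q\<close> edges and kernel \<open>{v}\<close>. As an edge meets
  \<open>U\<close> at most once and \<open>k \<ge> 3\<close>, it brings at least
  \<open>k - 2 \<ge> 1\<close> vertices outside \<open>U\<close> and \<open>v\<close>.\<close>

definition stars :: "nat \<Rightarrow> 'v set \<Rightarrow> 'v \<Rightarrow> 'v set set set" where
  "stars q U v = {F. F \<subseteq> {f \<in> E. v \<in> f \<and> card (f \<inter> U) \<le> 1} \<and> card F = q \<and> pairwise (\<lambda>f g. f \<inter> g = {v}) F}"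

text \<open>States that \<open>t\<close> rounds of the exploration started at \<open>U\<close> can
  succeed inside \<open>S\<close>; the vertices of each star join \<open>U\<close> before the next
  round.\<close>

primrec chain :: "nat \<Rightarrow> nat \<Rightarrow> 'v set \<Rightarrow> 'v set \<Rightarrow> bool" where
  "chain q 0 U S \<longleftrightarrow> True"
| "chain q (Suc t) U S \<longleftrightarrow> (\<exists>v\<in>V. \<exists>F\<in>stars q U v. \<Union>F \<subseteq> S \<and> chain q t (U \<union> \<Union>F) S)"

lemma finite_stars: "finite (stars q U v)"
  by (rule finite_subset[of _ "Pow E"]) (auto simp: stars_def finite_E)

lemma starsD:
  assumes "F \<in> stars q U v"
  shows "F \<subseteq> E" "finite F" "card F = q" "\<Union>F \<subseteq> V" "finite (\<Union>F)" "card (\<Union>F) \<le> q * k"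
    and "\<And>f. f \<in> F \<Longrightarrow> v \<in> f" "\<And>f. f \<in> F \<Longrightarrow> card (f \<inter> U) \<le> 1"
proof -
  show FE: "F \<subseteq> E" and c: "card F = q" using assms by (auto simp: stars_def)
  then show F: "finite F" using finite_E finite_subset by blast
  show "\<Union>F \<subseteq> V" using FE edge_subset by blast
  then show "finite (\<Union>F)" using finite_V finite_subset by blast
  have "card (\<Union>F) \<le> (\<Sum>f\<in>F. card f)" using card_UN_le[OF F, of id] by simp
  also have "\<dots> = (\<Sum>f\<in>F. k)" using FE edge_card by (intro sum.cong) auto
  finally show "card (\<Union>F) \<le> q * k" using c by simp
  show "\<And>f. f \<in> F \<Longrightarrow> v \<in> f" "\<And>f. f \<in> F \<Longrightarrow> card (f \<inter> U) \<le> 1"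
    using assms by (auto simp: stars_def)
qed

text \<open>A union bound over the star found in each round, where only the vertices outside the
  current \<open>U\<close> cost a factor \<open>p\<close>. The size condition ensures that
  \<open>U\<close> has at most \<open>M\<close> elements before every round, so that
  \<open>step\<close> applies; the last round may exceed \<open>M\<close>.\<close>

lemma chain_tail:
  assumes p: "0 \<le> p" "p \<le> 1" and "\<Gamma> \<ge> 0"
    and step: "\<And>U. U \<subseteq> V \<Longrightarrow> card U \<le> M \<Longrightarrow> (\<Sum>v\<in>V. \<Sum>F\<in>stars q U v. p ^ card (\<Union>F - U)) \<le> \<Gamma>"
    and "U \<subseteq> V" "card U + t * (q * k) \<le> M + q * k"
  shows "rprob V p (\<lambda>S. U \<subseteq> S \<and> chain q t U S) \<le> p ^ card U * \<Gamma> ^ t"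
  using assms(5,6)
proof (induction t arbitrary: U)
  case 0
  then show ?case using rprob_subset[OF finite_V _ p] by simp
next
  case (Suc t)
  have fU: "finite U" using Suc.prems finite_V finite_subset by blast
  let ?I = "SIGMA v:V. stars q U v"
  have "rprob V p (\<lambda>S. U \<subseteq> S \<and> chain q (Suc t) U S)
    \<le> (\<Sum>x\<in>?I. rprob V p (\<lambda>S. U \<union> \<Union>(snd x) \<subseteq> S \<and> chain q t (U \<union> \<Union>(snd x)) S))"
    by (rule rprob_UN) (use finite_V finite_stars in \<open>auto intro!: finite_SigmaI\<close>)
  also have "\<dots> \<le> (\<Sum>x\<in>?I. p ^ card (U \<union> \<Union>(snd x)) * \<Gamma> ^ t)"
  proof (intro sum_mono)
    fix x assume "x \<in> ?I"
    then have F: "snd x \<in> stars q U (fst x)" by auto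
    have "card (U \<union> \<Union>(snd x)) \<le> card U + q * k"
      using card_Un_le[of U "\<Union>(snd x)"] starsD(6)[OF F] by linarith
    then show "rprob V p (\<lambda>S. U \<union> \<Union>(snd x) \<subseteq> S \<and> chain q t (U \<union> \<Union>(snd x)) S) \<le> p ^ card (U \<union> \<Union>(snd x)) * \<Gamma> ^ t"
      using Suc.prems starsD(4)[OF F] by (intro Suc.IH) auto
  qed
  also have "\<dots> = (\<Sum>x\<in>?I. (p ^ card U * \<Gamma> ^ t) * p ^ card (\<Union>(snd x) - U))"
  proof (intro sum.cong refl)
    fix x assume "x \<in> ?I"
    then have F: "snd x \<in> stars q U (fst x)" by auto
    have "card (U \<union> \<Union>(snd x)) = card U + card (\<Union>(snd x) - U)"
      using card_Un_disjoint[of U "\<Union>(snd x) - U"] fU starsD(5)[OF F] by auto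
    then show "p ^ card (U \<union> \<Union>(snd x)) * \<Gamma> ^ t = (p ^ card U * \<Gamma> ^ t) * p ^ card (\<Union>(snd x) - U)"
      by (simp add: power_add)
  qed
  also have "\<dots> = (p ^ card U * \<Gamma> ^ t) * (\<Sum>v\<in>V. \<Sum>F\<in>stars q U v. p ^ card (\<Union>F - U))"
    using finite_V finite_stars
    by (simp add: sum.Sigma case_prod_beta flip: sum_distrib_left)
  also have "\<dots> \<le> (p ^ card U * \<Gamma> ^ t) * \<Gamma>"
    using Suc.prems assms(1-3) by (intro mult_left_mono step) auto
  finally show ?case by (simp add: mult_ac)
qed

text \<open>The weight of a star is at most the product of its edge weights \<open>w f\<close>. An
  edge has at least \<open>k - 1\<close> vertices outside \<open>U\<close> and \<open>v\<close>,
  except for at most \<open>card U * D\<close> edges through \<open>v\<close> and another vertex of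
  \<open>U\<close>, which still have \<open>k - 2\<close>. So the weights sum to at most
  \<open>l\<close>, and \<open>sum_prod_subsets_le\<close> finishes.\<close>

lemma sum_stars_le:
  assumes p: "0 \<le> p" "p \<le> 1" and q: "q > 0" and "finite U" and l: "l > 0"
    and l_ge: "real (card V) * D * p ^ (k - 1) + real (card U) * D * p ^ (k - 2) \<le> l"
  shows "(\<Sum>F\<in>stars q U v. p ^ card (\<Union>F - U)) \<le> (exp 1 * l / real q) ^ q"
proof -
  define A where "A = {f \<in> E. v \<in> f \<and> card (f \<inter> U) \<le> 1}"
  define w where "w f = p ^ card (f - insert v U)" for f
  have fA: "finite A" using finite_E by (simp add: A_def)
  have AE: "A \<subseteq> E" by (auto simp: A_def)
  let ?A0 = "{f \<in> E. v \<in> f}" and ?A1 = "{f \<in> A. \<exists>u\<in>U - {v}. u \<in> f}"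
  have w_le: "w f \<le> p ^ (k - 1) + of_bool (f \<in> ?A1) * p ^ (k - 2)" if f: "f \<in> A" for f
  proof -
    have ff: "finite f" "card f = k" "v \<in> f" using f AE finite_edge edge_card by (auto simp: A_def)
    show ?thesis
    proof (cases "f \<in> ?A1")
      case True
      have "card (insert v U \<inter> f) \<le> Suc (card (f \<inter> U))"
        using ff by (simp add: Int_insert_left card_insert_if Int_commute)
      also have "\<dots> \<le> 2" using f by (simp add: A_def)
      finally have "card (f - insert v U) \<ge> k - 2"
        using ff by (simp add: card_Diff_subset_Int Int_commute)
      then have "w f \<le> p ^ (k - 2)" unfolding w_def using p by (intro power_decreasing) auto
      then show ?thesis using True p by (simp add: add_increasing)
    next
      case False
      then have "f - insert v U = f - {v}" using f ff by auto
      then have "card (f - insert v U) = k - 1"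
        using ff by (simp add: card_Diff_singleton)
      then show ?thesis using False p by (simp add: w_def)
    qed
  qed
  have "sum w A \<le> (\<Sum>f\<in>A. p ^ (k - 1) + of_bool (f \<in> ?A1) * p ^ (k - 2))"
    using w_le by (rule sum_mono)
  also have "\<dots> = real (card A) * p ^ (k - 1) + (\<Sum>f\<in>A. of_bool (f \<in> ?A1)) * p ^ (k - 2)"
    by (simp add: sum.distrib sum_distrib_right)
  also have "(\<Sum>f\<in>A. of_bool (f \<in> ?A1)) = real (card ?A1)"
    using fA by (subst sum_of_bool_eq) (auto intro!: arg_cong[of _ _ card])
  also have "real (card A) * p ^ (k - 1) + real (card ?A1) * p ^ (k - 2)
      \<le> (real (card V) * D) * p ^ (k - 1) + (real (card U) * D) * p ^ (k - 2)"
  proof (intro add_mono mult_right_mono)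
    have "card A \<le> card ?A0" using finite_E by (intro card_mono) (auto simp: A_def)
    then show "real (card A) \<le> real (card V) * D" using degree[of v] by linarith
    have "real (card ?A1) \<le> real (card (U - {v})) * D"
    proof (rule card_UN_bound[where B = "\<lambda>u. {f \<in> E. u \<in> f \<and> v \<in> f}"])
      show "?A1 \<subseteq> (\<Union>u\<in>U - {v}. {f \<in> E. u \<in> f \<and> v \<in> f})" by (auto simp: A_def)
      show "real (card {f \<in> E. u \<in> f \<and> v \<in> f}) \<le> D" if "u \<in> U - {v}" for u
        using that by (intro codegree) auto
    qed (use assms finite_E in auto)
    also have "\<dots> \<le> real (card U) * D"
      using assms(4) D1 by (intro mult_right_mono) (auto intro: card_mono)
    finally show "real (card ?A1) \<le> real (card U) * D" .
  qed (use p in auto)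
  finally have wA: "sum w A \<le> l" using l_ge by simp
  have "(\<Sum>F\<in>stars q U v. p ^ card (\<Union>F - U)) \<le> (\<Sum>F\<in>stars q U v. prod w F)"
  proof (rule sum_mono)
    fix F assume F: "F \<in> stars q U v"
    have pw: "pairwise (\<lambda>f g. f \<inter> g = {v}) F" using F by (simp add: stars_def)
    \<comment> \<open>The edges of a star are disjoint away from \<open>v\<close>; the shared centre
      is left out of the count.\<close>
    have "(\<Sum>f\<in>F. card (f - insert v U)) = card (\<Union>f\<in>F. f - insert v U)"
    proof (rule card_UN_disjoint[symmetric])
      show "\<forall>f\<in>F. finite (f - insert v U)" using starsD(1)[OF F] finite_edge by auto
      show "\<forall>f\<in>F. \<forall>g\<in>F. f \<noteq> g \<longrightarrow> (f - insert v U) \<inter> (g - insert v U) = {}"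
        using pw by (fastforce simp: pairwise_def)
    qed (rule starsD(2)[OF F])
    also have "\<dots> \<le> card (\<Union>F - U)"
      using starsD(5)[OF F] by (intro card_mono) auto
    finally have "p ^ card (\<Union>F - U) \<le> p ^ (\<Sum>f\<in>F. card (f - insert v U))"
      using p by (intro power_decreasing) auto
    then show "p ^ card (\<Union>F - U) \<le> prod w F" by (simp add: w_def power_sum)
  qed
  also have "\<dots> \<le> (\<Sum>F | F \<subseteq> A \<and> card F = q. prod w F)"
    using fA p by (intro sum_mono2) (auto simp: stars_def A_def w_def intro!: prod_nonneg)
  also have "\<dots> \<le> (exp 1 * l / real q) ^ q"
    using fA p wA l q by (intro sum_prod_subsets_le) (auto simp: w_def)
  finally show ?thesis .
qed

text \<open>The set at which the exploration gets stuck. At most \<open>t - 1\<close> rounds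
  succeeded before, which is recorded additively to avoid truncated subtraction.\<close>

lemma not_chain_imp:
  assumes "\<not> chain q t U S" "U \<subseteq> S" "finite U"
  shows "\<exists>U'\<subseteq>S. finite U' \<and> card U' + q * k \<le> card U + t * (q * k) \<and> (\<forall>v\<in>V. \<forall>F\<in>stars q U' v. \<not> \<Union>F \<subseteq> S)"
  using assms
proof (induction t arbitrary: U)
  case 0
  then show ?case by simp
next
  case (Suc t)
  show ?case
  proof (cases "\<forall>v\<in>V. \<forall>F\<in>stars q U v. \<not> \<Union>F \<subseteq> S")
    case True
    then show ?thesis using Suc.prems by (intro exI[of _ U]) auto
  next
    case False
    then obtain v F where vF: "v \<in> V" "F \<in> stars q U v" "\<Union>F \<subseteq> S" by blast
    then have "\<not> chain q t (U \<union> \<Union>F) S" using Suc.prems(1) by auto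
    moreover have "finite (U \<union> \<Union>F)" using Suc.prems(3) starsD(5)[OF vF(2)] by simp
    ultimately obtain U' where U': "U' \<subseteq> S" "finite U'" "card U' + q * k \<le> card (U \<union> \<Union>F) + t * (q * k)"
        "\<forall>v\<in>V. \<forall>F\<in>stars q U' v. \<not> \<Union>F \<subseteq> S"
      using Suc.IH[of "U \<union> \<Union>F"] Suc.prems(2) vF(3) by auto
    have "card (U \<union> \<Union>F) \<le> card U + q * k"
      using card_Un_le[of U "\<Union>F"] starsD(6)[OF vF(2)] by linarith
    then show ?thesis using U' by (intro exI[of _ U']) auto
  qed
qed

text \<open>Take for \<open>J\<close> the spanned edges meeting the stuck set \<open>U\<close> at
  most once. A vertex of degree above \<open>q * k * D\<close> in \<open>J\<close> would give a star
  by \<open>star_matching\<close>, so the exploration could continue.\<close>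

lemma not_chain_imp_bounded_degree:
  assumes "\<not> chain q t {} S" "S \<subseteq> V" "t > 0"
  shows "\<exists>J\<subseteq>{f \<in> E. f \<subseteq> S}.
      real (card J) \<ge> real (card {f \<in> E. f \<subseteq> S}) - (real ((t - 1) * (q * k)))\<^sup>2 * D \<and>
      (\<forall>v. real (card {f \<in> J. v \<in> f}) \<le> real (q * k) * D)"
proof -
  obtain U where U: "U \<subseteq> S" "finite U" "card U + q * k \<le> t * (q * k)"
      "\<forall>v\<in>V. \<forall>F\<in>stars q U v. \<not> \<Union>F \<subseteq> S"
    using not_chain_imp[OF assms(1)] by auto
  have cU: "card U \<le> (t - 1) * (q * k)" using U(3) by (simp add: diff_mult_distrib)
  let ?X = "{f \<in> E. f \<subseteq> S}"
  define J where "J = {f \<in> ?X. card (f \<inter> U) \<le> 1}"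
  have "real (card (?X - J)) \<le> real (card {f \<in> E. card (f \<inter> U) \<ge> 2})"
    using finite_E by (auto simp: J_def intro!: card_mono)
  also have "\<dots> \<le> (real (card U))\<^sup>2 * D" using U by (intro edges_meeting_twice)
  also have "\<dots> \<le> (real ((t - 1) * (q * k)))\<^sup>2 * D"
    using cU D1 by (intro mult_right_mono power_mono) (auto simp flip: of_nat_mult)
  finally have "real (card (?X - J)) \<le> (real ((t - 1) * (q * k)))\<^sup>2 * D" .
  moreover have "card (?X - J) = card ?X - card J" "card J \<le> card ?X"
    using finite_E by (auto simp: J_def intro!: card_Diff_subset card_mono)
  ultimately have 1: "real (card J) \<ge> real (card ?X) - (real ((t - 1) * (q * k)))\<^sup>2 * D"
    by (simp add: of_nat_diff)
  have 2: "real (card {f \<in> J. v \<in> f}) \<le> real (q * k) * D" for v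
  proof (rule ccontr)
    assume *: "\<not> ?thesis"
    \<comment> \<open>Nonemptiness places \<open>v\<close> in \<open>V\<close>, the only vertices
      for which stars have been excluded.\<close>
    have "{f \<in> J. v \<in> f} \<noteq> {}"
    proof
      assume "{f \<in> J. v \<in> f} = {}"
      then have "real (card {f \<in> J. v \<in> f}) = 0" by (simp only: card.empty of_nat_0)
      with * D1 show False by simp
    qed
    then have vV: "v \<in> V" using edge_subset by (auto simp: J_def)
    have "{f \<in> J. v \<in> f} \<subseteq> {f \<in> E. v \<in> f}" by (auto simp: J_def)
    from star_matching[OF this, of q] * obtain F where
      F: "F \<subseteq> {f \<in> J. v \<in> f}" "card F = q" "pairwise (\<lambda>f g. f \<inter> g = {v}) F"
      by auto
    have "F \<in> stars q U v" using F by (auto simp: stars_def J_def)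
    moreover have "\<Union>F \<subseteq> S" using F by (auto simp: J_def)
    ultimately show False using U(4) vV by blast
  qed
  show ?thesis using 1 2 by (intro exI[of _ J]) (auto simp: J_def)
qed

text \<open>Either the exploration finds \<open>t\<close> stars of \<open>q\<close> edges, or it
  gets stuck and leaves a subhypergraph of small degree, in which sequences of \<open>m\<close>
  disjoint edges are counted with \<open>z\<close> choices each.\<close>

lemma upper_tail_split:
  assumes p: "0 \<le> p" "p \<le> 1" and z: "z > 0" and m: "m > 0" and t: "t > 0" and q: "q > 0" and l: "l > 0"
    and l_ge: "real (card V) * D * p ^ (k - 1) + real ((t - 1) * (q * k)) * D * p ^ (k - 2) \<le> l"
    and j: "x - (real ((t - 1) * (q * k)))\<^sup>2 * D - real k * (real m - 1) * (real (q * k) * D) \<ge> z"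
  shows "rprob V p (\<lambda>S. real (card {f \<in> E. f \<subseteq> S}) \<ge> x)
    \<le> (real (card E) * p ^ k / z) ^ m + (real (card V) * (exp 1 * l / real q) ^ q) ^ t"
proof -
  let ?M = "(t - 1) * (q * k)" and ?r = "real (q * k) * D"
  let ?\<Gamma> = "real (card V) * (exp 1 * l / real q) ^ q"
  let ?P = "\<lambda>S. \<exists>J\<subseteq>{f \<in> E. f \<subseteq> S}. real (card J) \<ge> x - (real ?M)\<^sup>2 * D \<and> (\<forall>v. real (card {f \<in> J. v \<in> f}) \<le> ?r)"
  have "rprob V p (\<lambda>S. real (card {f \<in> E. f \<subseteq> S}) \<ge> x) \<le> rprob V p ?P + rprob V p (\<lambda>S. {} \<subseteq> S \<and> chain q t {} S)"
  proof (rule rprob_disj)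
    fix S assume S: "S \<subseteq> V" "real (card {f \<in> E. f \<subseteq> S}) \<ge> x"
    show "?P S \<or> ({} \<subseteq> S \<and> chain q t {} S)"
    proof (cases "chain q t {} S")
      case False
      then obtain J where "J \<subseteq> {f \<in> E. f \<subseteq> S}"
          "real (card J) \<ge> real (card {f \<in> E. f \<subseteq> S}) - (real ?M)\<^sup>2 * D"
          "\<forall>v. real (card {f \<in> J. v \<in> f}) \<le> ?r"
        using not_chain_imp_bounded_degree[OF False S(1) t] by blast
      then have "?P S" using S(2) by (intro exI[of _ J]) simp
      then show ?thesis ..
    qed simp
  qed
  also have "rprob V p ?P \<le> (real (card E) * p ^ k / z) ^ m"
    using D1 j by (intro bounded_degree_tail p z m) auto
  also have "rprob V p (\<lambda>S. {} \<subseteq> S \<and> chain q t {} S) \<le> p ^ card ({} :: 'v set) * ?\<Gamma> ^ t"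
  proof (rule chain_tail[where M = ?M])
    fix U assume U: "U \<subseteq> V" "card U \<le> ?M"
    have "real (card U) * D * p ^ (k - 2) \<le> real ?M * D * p ^ (k - 2)"
      using U D1 p by (intro mult_right_mono) (auto simp del: of_nat_mult)
    then have "(\<Sum>F\<in>stars q U v. p ^ card (\<Union>F - U)) \<le> (exp 1 * l / real q) ^ q" for v
      using l_ge U finite_V by (intro sum_stars_le p q l) (auto intro: finite_subset)
    then show "(\<Sum>v\<in>V. \<Sum>F\<in>stars q U v. p ^ card (\<Union>F - U)) \<le> ?\<Gamma>"
      by (intro sum_bounded_above)
  next
    show "card {} + t * (q * k) \<le> (t - 1) * (q * k) + q * k"
      using t by (cases t) auto
  qed (use p l in auto)
  finally show ?thesis by simp
qed

end

subsection \<open>The upper bound\<close>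

lemma ln_one_plus_ge_half_min:
  fixes x :: real
  assumes "x \<ge> 0"
  shows "min x 1 / 2 \<le> ln (1 + x)"
proof -
  define e where "e = min x 1"
  have e: "0 \<le> e" "e \<le> 1" "e \<le> x" using assms by (auto simp: e_def)
  have "ln (1 / (1 + e)) \<le> 1 / (1 + e) - 1" using e by (intro ln_le_minus_one) simp
  then have "e / (1 + e) \<le> ln (1 + e)" using e by (simp add: ln_div field_simps)
  moreover have "e / 2 \<le> e / (1 + e)" using e by (intro divide_left_mono) auto
  moreover have "ln (1 + e) \<le> ln (1 + x)" using e by simp
  ultimately show ?thesis unfolding e_def by linarith
qed

text \<open>The factor 2 is absorbed by the trivial bound; this costs one factor \<open>min \<epsilon> 1\<close> in the exponent.\<close>

lemma exp_bound_absorb_two: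
  fixes P Z \<epsilon> :: real
  assumes "P \<le> 2 * exp (- Z)" "P \<le> 1 / (1 + \<epsilon>)" "\<epsilon> > 0"
  shows "P \<le> exp (- (min \<epsilon> 1 / 4 * Z))"
proof (cases "min \<epsilon> 1 / 4 * Z \<le> ln (1 + \<epsilon>)")
  case True
  have "P \<le> exp (- ln (1 + \<epsilon>))" using assms by (simp add: exp_minus inverse_eq_divide)
  then show ?thesis using True by (meson exp_le_cancel_iff neg_le_iff_le order_trans)
next
  \<comment> \<open>Markov's bound does not suffice here, but then \<open>Z > 2\<close>, and the
    factor 2 is at most \<open>exp 1\<close>, which the exponent can afford.\<close>
  case False
  have "ln (1 + \<epsilon>) \<ge> min \<epsilon> 1 / 2" using assms by (intro ln_one_plus_ge_half_min) simp
  with False have "min \<epsilon> 1 * 2 < min \<epsilon> 1 * Z" by simp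
  then have Z: "Z > 2" using assms by simp
  have "min \<epsilon> 1 / 4 * Z \<le> 1 / 4 * Z" using Z by (intro mult_right_mono) auto
  then have "1 + (- Z) \<le> - (min \<epsilon> 1 / 4 * Z)" using Z by linarith
  have "P \<le> exp 1 * exp (- Z)"
  proof -
    have "2 * exp (- Z) \<le> exp 1 * exp (- Z)"
      using exp_ge_add_one_self[of "1 :: real"] by (intro mult_right_mono) auto
    then show ?thesis using assms(1) by linarith
  qed
  also have "\<dots> = exp (1 + (- Z))" by (simp only: exp_add)
  also have "\<dots> \<le> exp (- (min \<epsilon> 1 / 4 * Z))" using \<open>1 + (- Z) \<le> _\<close> by simp
  finally show ?thesis .
qed

text \<open>Rounds \<open>x / y\<close> to a positive integer, also when \<open>x < y\<close>. The
  first inequality limits what the first \<open>m - 1\<close> rounds use up, the second makes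
  \<open>m\<close> large enough for the exponent.\<close>

lemma exists_nat_floor:
  fixes x y :: real
  assumes "x \<ge> 0" "y > 0"
  shows "\<exists>m>0. (real m - 1) * y \<le> x \<and> x \<le> real m * y"
proof -
  let ?m = "nat \<lfloor>x / y\<rfloor> + 1"
  have "0 \<le> x / y" using assms by simp
  then have "real ?m - 1 \<le> x / y" "x / y \<le> real ?m" by linarith+
  then have "(real ?m - 1) * y \<le> x" "x \<le> real ?m * y" "?m > 0"
    using assms by (simp_all only: pos_le_divide_eq pos_divide_le_eq)
  then show ?thesis by (intro exI[of _ ?m] conjI)
qed

text \<open>Compares the exponent that the method yields, of order
  \<open>\<epsilon> * \<mu> / q\<close>, with the desired minimum. The denominator is at most 2 or
  at most \<open>2 * Y / L\<close>, and these cases correspond to the two terms of the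
  minimum.\<close>

lemma min_sqrt_le:
  fixes \<epsilon> \<mu> L :: real
  assumes "\<epsilon> > 0" "\<mu> > 0" "L \<ge> 1"
  shows "min \<epsilon> (sqrt \<epsilon>) * min \<mu> (sqrt \<mu> * L) / 2 \<le> \<epsilon> * \<mu> / (1 + sqrt (max 1 \<epsilon> * \<mu>) / L)"
proof -
  define Y where "Y = sqrt (max 1 \<epsilon> * \<mu>)"
  have Y: "Y > 0" "Y = sqrt (max 1 \<epsilon>) * sqrt \<mu>" using assms by (auto simp: Y_def real_sqrt_mult)
  have pos: "0 < min \<epsilon> (sqrt \<epsilon>)" "0 < min \<mu> (sqrt \<mu> * L)" using assms by auto
  show ?thesis
  proof (cases "Y \<le> L")
    case True
    have "min \<epsilon> (sqrt \<epsilon>) * min \<mu> (sqrt \<mu> * L) / 2 \<le> \<epsilon> * \<mu> / 2"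
      using assms pos by (intro divide_right_mono mult_mono) auto
    also have "\<dots> \<le> \<epsilon> * \<mu> / (1 + Y / L)"
      using assms True Y by (intro divide_left_mono) (auto simp: add_pos_pos)
    finally show ?thesis by (simp add: Y_def)
  next
    case False
    have e: "min \<epsilon> (sqrt \<epsilon>) * sqrt (max 1 \<epsilon>) \<le> \<epsilon>"
    proof (cases "\<epsilon> \<le> 1")
      case True
      then show ?thesis using assms by (simp add: min.coboundedI1)
    next
      case False
      then have "min \<epsilon> (sqrt \<epsilon>) * sqrt (max 1 \<epsilon>) \<le> sqrt \<epsilon> * sqrt \<epsilon>"
        by (intro mult_mono) auto
      then show ?thesis using assms by simp
    qed
    have "min \<epsilon> (sqrt \<epsilon>) * min \<mu> (sqrt \<mu> * L) / 2 \<le> min \<epsilon> (sqrt \<epsilon>) * (sqrt \<mu> * L) / 2"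
      using assms pos by (intro divide_right_mono mult_left_mono) auto
    also have "\<dots> = (min \<epsilon> (sqrt \<epsilon>) * sqrt (max 1 \<epsilon>)) * \<mu> / (2 * Y / L)"
      using assms Y by (simp add: field_simps)
    also have "\<dots> \<le> \<epsilon> * \<mu> / (2 * Y / L)"
      using assms e Y by (intro divide_right_mono mult_right_mono) auto
    also have "\<dots> \<le> \<epsilon> * \<mu> / (1 + Y / L)"
      using assms False Y by (intro divide_left_mono) (auto simp: add_pos_pos field_simps)
    finally show ?thesis by (simp add: Y_def)
  qed
qed

section \<open>Choosing the parameters of the split\<close>

context almost_linear
begin

lemma expectation_edges:
  assumes "0 \<le> p" "p \<le> 1"
  shows "measure_pmf.expectation (random_set V p) (\<lambda>S. real (card {f \<in> E. f \<subseteq> S})) = real (card E) * p ^ k"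
proof -
  have "real (card {f \<in> E. f \<subseteq> S}) = (\<Sum>f\<in>E. of_bool (f \<subseteq> S))" for S
    using finite_E by (simp add: sum_of_bool_eq Int_def)
  then have "measure_pmf.expectation (random_set V p) (\<lambda>S. real (card {f \<in> E. f \<subseteq> S})) =
      (\<Sum>f\<in>E. measure_pmf.expectation (random_set V p) (\<lambda>S. of_bool (f \<subseteq> S)))"
    using integrable_random_set[OF finite_V] by (simp add: Bochner_Integration.integral_sum)
  also have "\<dots> = (\<Sum>f\<in>E. p ^ k)"
    using edge_card edge_subset by (intro sum.cong refl)
      (simp add: rprob_subset[OF finite_V _ assms] flip: rprob_expectation)
  finally show ?thesis by simp
qed

lemma upper_tail_Markov:
  assumes "0 \<le> p" "p \<le> 1" "\<epsilon> > 0" "\<mu> = real (card E) * p ^ k" "\<mu> > 0"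
  shows "rprob V p (\<lambda>S. real (card {f \<in> E. f \<subseteq> S}) \<ge> (1 + \<epsilon>) * \<mu>) \<le> 1 / (1 + \<epsilon>)"
proof -
  have "rprob V p (\<lambda>S. real (card {f \<in> E. f \<subseteq> S}) \<ge> (1 + \<epsilon>) * \<mu>) \<le> \<mu> / ((1 + \<epsilon>) * \<mu>)"
  proof -
    have "(1 + \<epsilon>) * \<mu> > 0" using assms(3,5) by simp
    from rprob_Markov[OF finite_V this,
        where f = "\<lambda>S. real (card {f \<in> E. f \<subseteq> S})" and P = "\<lambda>S. real (card {f \<in> E. f \<subseteq> S}) \<ge> (1 + \<epsilon>) * \<mu>" and p = p]
    show ?thesis using expectation_edges[OF assms(1,2)] assms(4) by simp
  qed
  also have "\<dots> = 1 / (1 + \<epsilon>)" using assms(5) by simp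
  finally show ?thesis .
qed

text \<open>The summands of \<open>K\<close> have separate purposes: 1 gives
  \<open>q \<ge> 1\<close>, the one with 36 makes the weight of each star decay like
  \<open>exp (- q * L / 4)\<close>, and the one with 8 pays for the choice of the centre among
  \<open>card V\<close> vertices.\<close>

lemma upper_tail_bound:
  fixes n a p \<epsilon> \<mu> :: real
  defines "K \<equiv> 1 + 36 * (D\<^sup>2 / sqrt a + D) + 8 * (D / sqrt a + real k + 1)"
  assumes a: "a > 0" and n: "n > 0" and V: "real (card V) \<le> D * n" and E: "real (card E) \<ge> a * n\<^sup>2"
    and p: "0 < p" "p \<le> 1" and \<epsilon>: "\<epsilon> > 0" and \<mu>_def: "\<mu> = real (card E) * p ^ k"
  shows "rprob V p (\<lambda>S. real (card {f \<in> E. f \<subseteq> S}) \<ge> (1 + \<epsilon>) * \<mu>)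
    \<le> exp (- (1 / (512 * (real k)\<^sup>2 * D * K) * min (\<epsilon> ^ 3) (\<epsilon> powr (1/2)) * min \<mu> (sqrt \<mu> * ln (exp 1 / p))))"
proof -
  define L where "L = 1 - ln p"
  define C1 where "C1 = D\<^sup>2 / sqrt a + D"
  define Y where "Y = sqrt (max 1 \<epsilon> * \<mu>)"
  define T where "T = min \<mu> (sqrt \<mu> * L)"
  define g where "g = sqrt p"
  have L: "L \<ge> 1" "ln (exp 1 / p) = L" using p by (auto simp: L_def ln_div)
  have sa: "sqrt a > 0" using a by simp
  have kpos: "real k \<ge> 3" using k3 by simp
  have C1: "C1 > 0" using sa D1 by (auto simp: C1_def intro!: add_nonneg_pos)
  have K: "K \<ge> 1" "K \<ge> 36 * C1" "K \<ge> 8 * (D / sqrt a + real k + 1)"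
    using sa D1 by (auto simp: K_def C1_def)
  have "a * n\<^sup>2 > 0" using a n by simp
  then have \<mu>: "\<mu> > 0" using E p by (auto simp: \<mu>_def)
  have Y: "Y > 0" "sqrt \<mu> \<le> Y" "sqrt (\<epsilon> * \<mu>) \<le> Y"
    using \<mu> \<epsilon> by (auto simp: Y_def mult_right_mono)
  have g: "0 < g" "g \<le> 1" "p = g\<^sup>2" using p by (auto simp: g_def)
  have gL: "g = exp ((1 - L) / 2)"
  proof -
    have "g = exp (ln g)" using g by simp
    also have "ln g = (1 - L) / 2" using p by (simp add: g_def L_def ln_sqrt)
    finally show ?thesis .
  qed
  \<comment> \<open>From \<open>\<mu> \<ge> a * n ^ 2 * p ^ k\<close>; in terms of
    \<open>g = sqrt p\<close> the number of vertices is thereby controlled by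
    \<open>sqrt \<mu>\<close>.\<close>
  have n_le: "n * g ^ k \<le> sqrt \<mu> / sqrt a"
  proof -
    have "(sqrt a * (n * g ^ k))\<^sup>2 = a * n\<^sup>2 * p ^ k"
      using a p by (simp add: power_mult_distrib g_def) (simp add: power_mult[symmetric] mult.commute[of k 2] power_mult real_sqrt_pow2)
    also have "\<dots> \<le> \<mu>" unfolding \<mu>_def using E p by (intro mult_right_mono) auto
    finally have "sqrt a * (n * g ^ k) \<le> sqrt \<mu>" by (rule real_le_rsqrt)
    then show ?thesis using sa by (simp add: field_simps)
  qed
  \<comment> \<open>Chosen so that \<open>q * L\<close> dominates \<open>L + Y\<close>. Rounding up
    at most doubles the value, which is at least 1.\<close>
  define q where "q = nat \<lceil>K * (1 + Y / L)\<rceil>"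
  have "K * (1 + Y / L) \<ge> 1 * 1" using K Y L by (intro mult_mono) auto
  then have q: "real q \<ge> K * (1 + Y / L)" "real q \<le> 2 * (K * (1 + Y / L))" "q > 0" "real q \<ge> 1"
    unfolding q_def by linarith+
  have qL: "real q * L \<ge> K * (L + Y)"
  proof -
    have "K * (1 + Y / L) * L \<le> real q * L" using q L by (intro mult_right_mono) auto
    then show ?thesis using L by (simp add: algebra_simps)
  qed
  define u where "u = sqrt (\<epsilon> * \<mu> / (2 * D))"
  have u: "u \<ge> 0" "u \<le> Y" "u\<^sup>2 * D = \<epsilon> * \<mu> / 2"
  proof -
    show "u \<ge> 0" using \<epsilon> \<mu> D1 by (simp add: u_def)
    have "\<epsilon> * \<mu> / (2 * D) \<le> \<epsilon> * \<mu> / 1" using \<epsilon> \<mu> D1 by (intro divide_left_mono) auto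
    then have "u \<le> sqrt (\<epsilon> * \<mu>)" unfolding u_def by (intro real_sqrt_le_mono) simp
    then show "u \<le> Y" using Y(3) by linarith
    show "u\<^sup>2 * D = \<epsilon> * \<mu> / 2" using \<epsilon> \<mu> D1 by (simp add: u_def field_simps)
  qed
  have qk: "real (q * k) > 0" using q kpos by simp
  obtain t where t: "t > 0" "(real t - 1) * real (q * k) \<le> u" "u \<le> real t * real (q * k)"
    using exists_nat_floor[OF u(1) qk] by blast
  have r: "real k * (real (q * k) * D) > 0" using qk kpos D1 by simp
  obtain m where m: "m > 0" "(real m - 1) * (real k * (real (q * k) * D)) \<le> \<epsilon> * \<mu> / 4"
      "\<epsilon> * \<mu> / 4 \<le> real m * (real k * (real (q * k) * D))"
    using exists_nat_floor[OF _ r, of "\<epsilon> * \<mu> / 4"] \<epsilon> \<mu> by auto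
  have tq: "real ((t - 1) * (q * k)) \<le> u" "real ((t - 1) * (q * k)) \<ge> 0" using t by (auto simp: of_nat_diff)
  define l where "l = C1 * Y * g"
  have l: "l > 0" using C1 Y g by (simp add: l_def)
  have l_ge: "real (card V) * D * p ^ (k - 1) + real ((t - 1) * (q * k)) * D * p ^ (k - 2) \<le> l"
  proof -
    \<comment> \<open>Here and in \<open>pk2\<close> the condition \<open>k \<ge> 3\<close> leaves a
      spare factor \<open>g\<close>: \<open>2 * (k - 1) \<ge> k + 1\<close> and
      \<open>2 * (k - 2) \<ge> 1\<close>.\<close>
    have pk1: "p ^ (k - 1) \<le> g ^ k * g"
    proof -
      have "p ^ (k - 1) = g ^ (2 * (k - 1))" by (simp add: g(3) power_mult)
      also have "\<dots> \<le> g ^ (k + 1)" using g k3 by (intro power_decreasing) auto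
      finally show ?thesis by (simp add: mult.commute)
    qed
    have pk2: "p ^ (k - 2) \<le> g"
    proof -
      have "p ^ (k - 2) = g ^ (2 * (k - 2))" by (simp add: g(3) power_mult)
      also have "\<dots> \<le> g ^ 1" using g k3 by (intro power_decreasing) auto
      finally show ?thesis by simp
    qed
    have "real (card V) * D * p ^ (k - 1) \<le> (D * n) * D * (g ^ k * g)"
      using V D1 n p pk1 g by (intro mult_mono) auto
    also have "\<dots> = D\<^sup>2 * g * (n * g ^ k)" by (simp add: power2_eq_square)
    also have "\<dots> \<le> D\<^sup>2 * g * (sqrt \<mu> / sqrt a)" using n_le D1 g by (intro mult_left_mono) auto
    also have "\<dots> \<le> D\<^sup>2 * g * (Y / sqrt a)"
      using Y sa D1 g by (intro mult_left_mono divide_right_mono) auto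
    finally have 1: "real (card V) * D * p ^ (k - 1) \<le> D\<^sup>2 * g * (Y / sqrt a)" .
    have "real ((t - 1) * (q * k)) * D * p ^ (k - 2) \<le> Y * D * g"
      using tq u D1 pk2 g p Y by (intro mult_mono) auto
    with 1 show ?thesis by (simp add: l_def C1_def algebra_simps)
  qed
  \<comment> \<open>Of the surplus \<open>\<epsilon> * \<mu>\<close>, at most one half is lost with
    the edges meeting \<open>U\<close> twice, by the choice of \<open>u\<close>, and at most a
    quarter in the greedy choice, by the choice of \<open>m\<close>. This leaves
    \<open>z = (1 + \<epsilon> / 4) * \<mu>\<close>.\<close>
  have "rprob V p (\<lambda>S. real (card {f \<in> E. f \<subseteq> S}) \<ge> (1 + \<epsilon>) * \<mu>)
    \<le> (real (card E) * p ^ k / ((1 + \<epsilon> / 4) * \<mu>)) ^ m + (real (card V) * (exp 1 * l / real q) ^ q) ^ t"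
  proof (rule upper_tail_split[OF _ p(2) _ m(1) t(1) q(3) l l_ge])
    have "(real ((t - 1) * (q * k)))\<^sup>2 * D \<le> u\<^sup>2 * D"
      using tq D1 by (intro mult_right_mono power_mono) auto
    then show "(1 + \<epsilon> / 4) * \<mu> \<le> (1 + \<epsilon>) * \<mu> - (real ((t - 1) * (q * k)))\<^sup>2 * D - real k * (real m - 1) * (real (q * k) * D)"
      using m(2) u(3) by (simp add: algebra_simps)
  qed (use p \<mu> \<epsilon> in auto)
  also have "(real (card E) * p ^ k / ((1 + \<epsilon> / 4) * \<mu>)) ^ m = (1 / (1 + \<epsilon> / 4)) ^ m"
    using \<mu> by (simp flip: \<mu>_def)
  also have "\<dots> = exp (- (real m * ln (1 + \<epsilon> / 4)))"
    using \<epsilon> by (simp add: exp_minus exp_of_nat_mult power_divide inverse_eq_divide power_one_over)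
  finally have P1: "rprob V p (\<lambda>S. real (card {f \<in> E. f \<subseteq> S}) \<ge> (1 + \<epsilon>) * \<mu>)
    \<le> exp (- (real m * ln (1 + \<epsilon> / 4))) + (real (card V) * (exp 1 * l / real q) ^ q) ^ t" .
  \<comment> \<open>The factor \<open>min \<epsilon> 1\<close> comes from
    \<open>ln (1 + \<epsilon> / 4)\<close>, the other one from the lower bound on \<open>m\<close>
    through \<open>min_sqrt_le\<close>.\<close>
  define M where "M = min \<epsilon> 1 * min \<epsilon> (sqrt \<epsilon>)"
  define c where "c = 1 / (128 * (real k)\<^sup>2 * D * K)"
  have M: "M \<ge> 0" "M \<le> sqrt \<epsilon>" using \<epsilon> mult_mono[of "min \<epsilon> 1" 1 "min \<epsilon> (sqrt \<epsilon>)" "sqrt \<epsilon>"] by (auto simp: M_def)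
  have c: "c > 0" using kpos D1 K by (simp add: c_def)
  have T: "T > 0" "T \<le> sqrt \<mu> * L" using \<mu> L by (auto simp: T_def)
  have E1: "real m * ln (1 + \<epsilon> / 4) \<ge> c * M * T"
  proof -
    have ln: "ln (1 + \<epsilon> / 4) \<ge> min \<epsilon> 1 / 8"
      using ln_one_plus_ge_half_min[of "\<epsilon> / 4"] \<epsilon> by (auto simp: min_def split: if_splits)
    have "min \<epsilon> (sqrt \<epsilon>) * T / 2 \<le> \<epsilon> * \<mu> / (1 + Y / L)"
      unfolding T_def Y_def by (rule min_sqrt_le[OF \<epsilon> \<mu> L(1)])
    also have "\<dots> = \<epsilon> * \<mu> * (2 * K) / (2 * (K * (1 + Y / L)))" using K by simp
    also have "\<dots> \<le> \<epsilon> * \<mu> * (2 * K) / real q"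
      using q \<epsilon> \<mu> K Y L by (intro divide_left_mono mult_pos_pos add_pos_pos divide_pos_pos) auto
    also have "\<dots> \<le> real m * (8 * (real k)\<^sup>2 * D * K)"
    proof -
      have "\<epsilon> * \<mu> * (2 * K) = (\<epsilon> * \<mu> / 4) * (8 * K)" by simp
      also have "\<dots> \<le> (real m * (real k * (real (q * k) * D))) * (8 * K)"
        using m(3) K by (intro mult_right_mono) auto
      finally show ?thesis using q by (simp add: field_simps power2_eq_square)
    qed
    finally have mm: "real m \<ge> 8 * c * (min \<epsilon> (sqrt \<epsilon>) * T)"
      using kpos D1 K by (simp add: c_def field_simps)
    have "c * M * T = (8 * c * (min \<epsilon> (sqrt \<epsilon>) * T)) * (min \<epsilon> 1 / 8)" by (simp add: M_def)
    also have "\<dots> \<le> real m * ln (1 + \<epsilon> / 4)"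
      using mm ln \<epsilon> c T by (intro mult_mono) auto
    finally show ?thesis .
  qed
  \<comment> \<open>One round costs at most \<open>exp (- q * L / 4)\<close> for the star and
    \<open>exp (q * L / 8)\<close> for its centre, so \<open>t\<close> rounds give
    \<open>exp (- t * q * L / 8)\<close>, and \<open>t * q * k \<ge> u\<close> is of order
    \<open>sqrt (\<epsilon> * \<mu>)\<close>.\<close>
  have E2: "(real (card V) * (exp 1 * l / real q) ^ q) ^ t \<le> exp (- (c * M * T))"
  proof -
    have "exp 1 * l / real q \<le> exp (- (L / 4))"
    proof -
      \<comment> \<open>Half of the decay of \<open>g\<close>, which is of order
        \<open>exp (- L / 2)\<close>, absorbs the factor \<open>L\<close>; this produces
        \<open>36 = 9 * 4\<close>. The other half survives.\<close>
      have "L * exp (- (L / 4)) \<le> 4"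
        using exp_ge_add_one_self[of "L / 4"] by (simp add: exp_minus field_simps)
      moreover have "exp (3 / 2 :: real) \<le> 9"
      proof -
        have "exp (3 / 2 :: real) \<le> exp (1 + 1)" by simp
        also have "\<dots> = exp 1 * exp (1::real)" by (rule exp_add)
        also have "\<dots> \<le> 3 * 3" using exp_le by (intro mult_mono) auto
        finally show ?thesis by simp
      qed
      ultimately have "exp (3 / 2) * (L * exp (- (L / 4))) \<le> 9 * 4"
        using L by (intro mult_mono) auto
      moreover have "exp 1 * (g * L) = (exp (3 / 2) * (L * exp (- (L / 4)))) * exp (- (L / 4))"
        by (simp add: gL mult_ac flip: exp_add) (simp add: field_simps)
      ultimately have "exp 1 * (g * L) \<le> (9 * 4) * exp (- (L / 4))"
        by (simp only: mult_right_mono exp_ge_zero)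
      then have "exp 1 * (g * L) \<le> 36 * exp (- (L / 4))" by simp
      then have "C1 * Y * (exp 1 * (g * L)) \<le> C1 * Y * (36 * exp (- (L / 4)))"
        using C1 Y by (intro mult_left_mono) auto
      also have "\<dots> = (36 * C1) * (Y * exp (- (L / 4)))" by simp
      also have "\<dots> \<le> K * (Y * exp (- (L / 4)))" using K Y by (intro mult_right_mono) auto
      also have "\<dots> \<le> K * ((L + Y) * exp (- (L / 4)))"
        using K Y L by (intro mult_left_mono mult_right_mono) auto
      also have "\<dots> \<le> real q * L * exp (- (L / 4))"
        using qL by (simp flip: mult.assoc)
      finally have "(exp 1 * l) * L \<le> (real q * exp (- (L / 4))) * L" by (simp add: l_def mult_ac)
      then have "exp 1 * l \<le> real q * exp (- (L / 4))" using L by simp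
      then show ?thesis using q by (simp add: field_simps)
    qed
    then have "(exp 1 * l / real q) ^ q \<le> exp (- (L / 4)) ^ q"
      using l q by (intro power_mono) auto
    also have "\<dots> = exp (- (real q * L / 4))" by (simp flip: exp_of_nat_mult)
    finally have G1: "(exp 1 * l / real q) ^ q \<le> exp (- (real q * L / 4))" .
    \<comment> \<open>By \<open>n_le\<close>, \<open>card V\<close> is at most a constant times
      \<open>sqrt \<mu>\<close> times a power of \<open>1 / p\<close>, all of which
      \<open>exp (q * L / 8)\<close> exceeds.\<close>
    have G2: "real (card V) \<le> exp (real q * L / 8)"
    proof -
      have "1 / g = exp (- ((1 - L) / 2))" unfolding gL exp_minus inverse_eq_divide ..
      also have "- ((1 - L) / 2) = (L - 1) / 2" by argo
      finally have "(1 / g) ^ k = exp (real k * ((L - 1) / 2))" by (simp only: exp_of_nat_mult)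
      then have "1 / g ^ k = exp (real k * ((L - 1) / 2))" by (simp add: power_one_over)
      also have "\<dots> \<le> exp (real k * L)"
        unfolding exp_le_cancel_iff using L(1) by (intro mult_left_mono) auto
      finally have gk: "1 / g ^ k \<le> exp (real k * L)" .
      have "real (card V) \<le> D * n" by (rule V)
      also have "\<dots> \<le> D * (sqrt \<mu> / sqrt a * (1 / g ^ k))"
      proof (rule mult_left_mono)
        have "n = (n * g ^ k) * (1 / g ^ k)" using g by simp
        also have "\<dots> \<le> sqrt \<mu> / sqrt a * (1 / g ^ k)" using n_le g by (intro mult_right_mono) auto
        finally show "n \<le> sqrt \<mu> / sqrt a * (1 / g ^ k)" .
      qed (use D1 in simp)
      also have "\<dots> = (D / sqrt a) * sqrt \<mu> * (1 / g ^ k)" by simp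
      also have "\<dots> \<le> exp (D / sqrt a) * exp (sqrt \<mu>) * exp (real k * L)"
      proof -
        have "x \<le> exp x" for x :: real using exp_ge_add_one_self[of x] by linarith
        then show ?thesis using gk a D1 \<mu> g by (intro mult_mono) auto
      qed
      also have "\<dots> = exp (D / sqrt a + sqrt \<mu> + real k * L)" by (simp add: exp_add)
      also have "\<dots> \<le> exp (real q * L / 8)"
      proof -
        have "D / sqrt a * 1 \<le> D / sqrt a * (L + Y)" using sa D1 L Y by (intro mult_left_mono) auto
        moreover have "real k * L \<le> real k * (L + Y)" using Y by (intro mult_left_mono) auto
        moreover have "(D / sqrt a + real k + 1) * (L + Y) = D / sqrt a * (L + Y) + real k * (L + Y) + (L + Y)"
          by (simp add: distrib_right)
        ultimately have "D / sqrt a + sqrt \<mu> + real k * L \<le> (D / sqrt a + real k + 1) * (L + Y)"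
          using Y L by linarith
        also have "\<dots> \<le> K / 8 * (L + Y)"
        proof (rule mult_right_mono)
          have "x \<le> K / 8" if "8 * x \<le> K" for x using that by simp
          then show "D / sqrt a + real k + 1 \<le> K / 8" using K(3) by blast
          show "0 \<le> L + Y" using L(1) Y(1) by linarith
        qed
        also have "\<dots> \<le> real q * L / 8" using qL by simp
        finally show ?thesis by simp
      qed
      finally show ?thesis .
    qed
    have "real (card V) * (exp 1 * l / real q) ^ q \<le> exp (real q * L / 8) * exp (- (real q * L / 4))"
      using G1 G2 l q by (intro mult_mono) auto
    also have "\<dots> = exp (- (real q * L / 8))" by (simp flip: exp_add)
    finally have "(real (card V) * (exp 1 * l / real q) ^ q) ^ t \<le> exp (- (real q * L / 8)) ^ t"
      using l q by (intro power_mono) auto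
    also have "\<dots> = exp (- (real t * real q * L / 8))" by (simp flip: exp_of_nat_mult)
    also have "\<dots> \<le> exp (- (c * M * T))"
    proof -
      have "c * M * T \<le> c * sqrt \<epsilon> * (sqrt \<mu> * L)"
        using c M T \<epsilon> \<mu> L by (intro mult_mono) auto
      also have "\<dots> = c * (sqrt (\<epsilon> * \<mu>) * L)" by (simp add: real_sqrt_mult)
      also have "\<dots> \<le> (1 / (16 * real k * D)) * (sqrt (\<epsilon> * \<mu>) * L)"
      proof (rule mult_right_mono)
        have "16 * real k * D * (1 * 1) \<le> 16 * real k * D * ((8 * real k) * K)"
          using kpos D1 K by (intro mult_left_mono mult_mono) auto
        then show "c \<le> 1 / (16 * real k * D)"
          unfolding c_def using kpos D1 K by (intro divide_left_mono) (auto simp: power2_eq_square mult_ac)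
      qed (use \<epsilon> \<mu> L in auto)
      also have "\<dots> \<le> (1 / (8 * real k)) * (u * L)"
      proof -
        have "sqrt (\<epsilon> * \<mu>) = sqrt (2 * D) * u"
          using D1 by (simp add: u_def real_sqrt_divide)
        also have "\<dots> \<le> (2 * D) * u"
          using D1 u by (intro mult_right_mono real_le_lsqrt) (auto simp: power2_eq_square)
        finally have "sqrt (\<epsilon> * \<mu>) * L \<le> (2 * D) * u * L" using L by (intro mult_right_mono) auto
        then show ?thesis using kpos D1 by (simp add: field_simps)
      qed
      also have "\<dots> \<le> (1 / (8 * real k)) * (real t * real (q * k) * L)"
        using t L kpos by (intro mult_left_mono mult_right_mono) auto
      also have "\<dots> = real t * real q * L / 8" using kpos by simp
      finally show ?thesis by simp
    qed
    finally show ?thesis .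
  qed
  have "exp (- (real m * ln (1 + \<epsilon> / 4))) \<le> exp (- (c * M * T))" using E1 by simp
  with P1 E2 have "rprob V p (\<lambda>S. real (card {f \<in> E. f \<subseteq> S}) \<ge> (1 + \<epsilon>) * \<mu>) \<le> 2 * exp (- (c * M * T))"
    by linarith
  from exp_bound_absorb_two[OF this upper_tail_Markov[OF _ p(2) \<epsilon> \<mu>_def \<mu>] \<epsilon>] p
  have "rprob V p (\<lambda>S. real (card {f \<in> E. f \<subseteq> S}) \<ge> (1 + \<epsilon>) * \<mu>) \<le> exp (- (min \<epsilon> 1 / 4 * (c * M * T)))"
    by simp
  \<comment> \<open>For \<open>\<epsilon> \<le> 1\<close> the value of \<open>M\<close> is
    \<open>\<epsilon> ^ 2\<close>; the factor \<open>min \<epsilon> 1\<close> from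
    \<open>exp_bound_absorb_two\<close> makes it the cube.\<close>
  also have "\<dots> \<le> exp (- (c / 4 * min (\<epsilon> ^ 3) (\<epsilon> powr (1/2)) * T))"
  proof -
    have "min (\<epsilon> ^ 3) (\<epsilon> powr (1/2)) \<le> min \<epsilon> 1 * M"
    proof (cases "\<epsilon> \<le> 1")
      case True
      then have "\<epsilon> * 1 \<le> sqrt \<epsilon> * 1"
        using \<epsilon> by (simp add: real_le_rsqrt power2_eq_square mult_left_le)
      then show ?thesis using True \<epsilon> by (simp add: M_def min_def power3_eq_cube)
    next
      case False
      then have "sqrt \<epsilon> \<le> \<epsilon>" using \<epsilon> by (intro real_le_lsqrt) (auto simp: power2_eq_square)
      then show ?thesis using False \<epsilon> by (simp add: M_def min_def powr_half_sqrt)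
    qed
    then have "min (\<epsilon> ^ 3) (\<epsilon> powr (1/2)) * (c / 4 * T) \<le> (min \<epsilon> 1 * M) * (c / 4 * T)"
      using c T by (intro mult_right_mono) auto
    then show ?thesis by (simp add: mult_ac)
  qed
  finally show ?thesis unfolding L(2) by (simp add: c_def T_def mult.assoc)
qed

end

subsection \<open>The lower bound\<close>

context almost_linear
begin

text \<open>For a good set \<open>A\<close> the random set can span \<open>A\<close> and no other edge, so distinct good sets
  give disjoint nonempty events.\<close>

definition good :: "'v set set \<Rightarrow> bool" where
  "good A \<longleftrightarrow> A \<subseteq> E \<and> (\<forall>f\<in>E. f \<subseteq> \<Union>A \<longrightarrow> f \<in> A)"

lemma card_Union_edges:
  assumes "A \<subseteq> E"
  shows "finite (\<Union>A)" "card (\<Union>A) \<le> k * card A" "\<Union>A \<subseteq> V"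
proof -
  have fA: "finite A" using assms finite_E finite_subset by blast
  show "\<Union>A \<subseteq> V" using assms edge_subset by blast
  then show "finite (\<Union>A)" using finite_V finite_subset by blast
  have "card (\<Union>A) \<le> (\<Sum>f\<in>A. card f)" using card_UN_le[OF fA, of id] by simp
  also have "\<dots> = (\<Sum>f\<in>A. k)" using assms edge_card by (intro sum.cong) auto
  finally show "card (\<Union>A) \<le> k * card A" by (simp add: mult.commute)
qed

lemma edges_meeting:
  assumes "finite U"
  shows "real (card {f \<in> E. f \<inter> U \<noteq> {}}) \<le> real (card U) * (real (card V) * D)"
  by (rule card_UN_bound[where B = "\<lambda>u. {f \<in> E. u \<in> f}"]) (use assms finite_E degree in auto)

text \<open>A new spanned edge \<open>f\<close> lies in \<open>e \<union> \<Union>A\<close> but in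
  neither part. Since \<open>k \<ge> 3\<close>, it meets one of the two parts twice, and it meets
  the other at least once.\<close>

lemma not_good_insert:
  assumes "good A" "e \<in> E" "\<not> good (insert e A)"
  shows "(\<exists>f\<in>{f \<in> E. card (f \<inter> \<Union>A) \<ge> 2}. e \<inter> f \<noteq> {}) \<or>
         (\<exists>f\<in>{f \<in> E. f \<inter> \<Union>A \<noteq> {}}. card (e \<inter> f) \<ge> 2)"
proof -
  have "insert e A \<subseteq> E" using assms by (auto simp: good_def)
  then obtain f where f: "f \<in> E" "f \<subseteq> e \<union> \<Union>A" "f \<noteq> e" "f \<notin> A"
    using assms(3) by (auto simp: good_def)
  have ff: "finite f" "card f = k" using f finite_edge edge_card by auto
  have "\<not> f \<subseteq> \<Union>A" using assms(1) f by (auto simp: good_def)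
  then have 1: "e \<inter> f \<noteq> {}" using f(2) by blast
  have "\<not> f \<subseteq> e"
    using f(1,3) assms(2) edge_card finite_edge card_subset_eq by metis
  then have 2: "f \<inter> \<Union>A \<noteq> {}" using f(2) by blast
  have "f = (e \<inter> f) \<union> (f \<inter> \<Union>A)" using f(2) by blast
  then have "k \<le> card (e \<inter> f) + card (f \<inter> \<Union>A)"
    using ff card_Un_le[of "e \<inter> f" "f \<inter> \<Union>A"] by metis
  then have "card (e \<inter> f) \<ge> 2 \<or> card (f \<inter> \<Union>A) \<ge> 2" using k3 by linarith
  then show ?thesis using 1 2 f(1) by blast
qed

text \<open>Both kinds of bad edges from \<open>not_good_insert\<close> number at most a constant
  times \<open>m ^ 2 * card V\<close>: few \<open>f\<close> with many \<open>e\<close> each, or more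
  \<open>f\<close> with a bounded number of \<open>e\<close> each. With \<open>m_small\<close> at
  least half of the edges remain.\<close>

lemma card_good_extensions:
  assumes A: "good A" and m: "card A \<le> m"
    and m_small: "real m + 2 * real k ^ 3 * D\<^sup>2 * (real m)\<^sup>2 * real (card V) \<le> real (card E) / 2"
  shows "real (card {e \<in> E - A. good (insert e A)}) \<ge> real (card E) / 2"
proof -
  let ?U = "\<Union>A" and ?N = "real (card V)"
  have AE: "A \<subseteq> E" using A by (simp add: good_def)
  note U = card_Union_edges[OF AE]
  let ?F1 = "{f \<in> E. card (f \<inter> ?U) \<ge> 2}" and ?F2 = "{f \<in> E. f \<inter> ?U \<noteq> {}}"
  let ?B1 = "\<Union>f\<in>?F1. {e \<in> E. e \<inter> f \<noteq> {}}" and ?B2 = "\<Union>f\<in>?F2. {e \<in> E. card (e \<inter> f) \<ge> 2}"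
  let ?w = "real k * real m"
  have w: "real (card ?U) \<le> ?w"
  proof -
    have "card ?U \<le> k * m" using U(2) m by (meson le_trans mult_le_mono2)
    then show ?thesis unfolding of_nat_mult[symmetric] by (rule of_nat_mono)
  qed
  have "real (card ?B1) \<le> real (card ?F1) * (real k * (?N * D))"
  proof (rule card_UN_bound[where B = "\<lambda>f. {e \<in> E. e \<inter> f \<noteq> {}}"])
    show "real (card {e \<in> E. e \<inter> f \<noteq> {}}) \<le> real k * (?N * D)" if "f \<in> ?F1" for f
      using edges_meeting[of f] that finite_edge edge_card by auto
  qed (use finite_E in auto)
  also have "\<dots> \<le> (?w\<^sup>2 * D) * (real k * (?N * D))"
  proof (rule mult_right_mono)
    have "real (card ?F1) \<le> (real (card ?U))\<^sup>2 * D" by (rule edges_meeting_twice[OF U(1)])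
    also have "\<dots> \<le> ?w\<^sup>2 * D" using w D1 by (intro mult_right_mono power_mono) auto
    finally show "real (card ?F1) \<le> ?w\<^sup>2 * D" .
  qed (use D1 in auto)
  finally have B1: "real (card ?B1) \<le> (?w\<^sup>2 * D) * (real k * (?N * D))" .
  have "real (card ?B2) \<le> real (card ?F2) * ((real k)\<^sup>2 * D)"
  proof (rule card_UN_bound[where B = "\<lambda>f. {e \<in> E. card (e \<inter> f) \<ge> 2}"])
    show "real (card {e \<in> E. card (e \<inter> f) \<ge> 2}) \<le> (real k)\<^sup>2 * D" if "f \<in> ?F2" for f
      using edges_meeting_twice[of f] that finite_edge edge_card by auto
  qed (use finite_E in auto)
  also have "\<dots> \<le> (?w * (?N * D)) * ((real k)\<^sup>2 * D)"
  proof (rule mult_right_mono)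
    have "real (card ?F2) \<le> real (card ?U) * (?N * D)" by (rule edges_meeting[OF U(1)])
    also have "\<dots> \<le> ?w * (?N * D)" using w D1 by (intro mult_right_mono) auto
    finally show "real (card ?F2) \<le> ?w * (?N * D)" .
  qed (use D1 in auto)
  finally have B2: "real (card ?B2) \<le> (?w * (?N * D)) * ((real k)\<^sup>2 * D)" .
  have "real m \<le> (real m)\<^sup>2" by (cases m) (auto simp: power2_eq_square)
  then have "real m * (real k ^ 3 * D\<^sup>2 * ?N) \<le> (real m)\<^sup>2 * (real k ^ 3 * D\<^sup>2 * ?N)"
    using D1 by (intro mult_right_mono) auto
  then have "(?w\<^sup>2 * D) * (real k * (?N * D)) + (?w * (?N * D)) * ((real k)\<^sup>2 * D)
      \<le> 2 * real k ^ 3 * D\<^sup>2 * (real m)\<^sup>2 * ?N"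
    by (simp add: power2_eq_square power3_eq_cube mult_ac)
  with B1 B2 m m_small have small: "real (card A) + real (card ?B1) + real (card ?B2) \<le> real (card E) / 2"
    by linarith
  have "E \<subseteq> {e \<in> E - A. good (insert e A)} \<union> (A \<union> (?B1 \<union> ?B2))"
  proof
    fix e assume e: "e \<in> E"
    show "e \<in> {e \<in> E - A. good (insert e A)} \<union> (A \<union> (?B1 \<union> ?B2))"
    proof (cases "good (insert e A)")
      case False
      from not_good_insert[OF A e False] e show ?thesis by blast
    qed (use e in auto)
  qed
  then have "card E \<le> card ({e \<in> E - A. good (insert e A)} \<union> (A \<union> (?B1 \<union> ?B2)))"
    using finite_E AE finite_subset[OF AE] by (intro card_mono) auto
  also have "\<dots> \<le> card {e \<in> E - A. good (insert e A)} + (card A + (card ?B1 + card ?B2))"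
    by (intro order_trans[OF card_Un_le] add_mono order_refl)
  finally have "real (card E) \<le> real (card {e \<in> E - A. good (insert e A)}) + (real (card A) + (real (card ?B1) + real (card ?B2)))"
    unfolding of_nat_add[symmetric] by (rule of_nat_mono)
  then show ?thesis using small by linarith
qed

text \<open>Double counting of pairs of a good set and an extending edge: each good set of size
  \<open>i + 1\<close> arises in at most \<open>i + 1\<close> ways, which builds up the
  factorial.\<close>

lemma card_good_sets:
  assumes m_small: "real m + 2 * real k ^ 3 * D\<^sup>2 * (real m)\<^sup>2 * real (card V) \<le> real (card E) / 2"
    and "i \<le> m"
  shows "real (card {A. good A \<and> card A = i}) \<ge> (real (card E) / 2) ^ i / fact i"
  using assms(2)
proof (induction i)
  case 0
  have "f \<noteq> {}" if "f \<in> E" for f using edge_card[OF that] k3 by auto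
  moreover have "A = {}" if "A \<subseteq> E" "card A = 0" for A
    using that finite_subset[OF that(1) finite_E] by simp
  ultimately have "{A. good A \<and> card A = 0} = {{}}" by (auto simp: good_def)
  then show ?case by simp
next
  case (Suc i)
  let ?G = "\<lambda>i. {A. good A \<and> card A = i}"
  have fG: "finite (?G i)" for i
    by (rule finite_subset[of _ "Pow E"]) (auto simp: good_def finite_E)
  have finA: "finite A" if "good A" for A using that finite_E finite_subset by (auto simp: good_def)
  let ?P = "SIGMA A:?G i. {e \<in> E - A. good (insert e A)}" and ?Q = "SIGMA A:?G (Suc i). A"
  have "inj_on (\<lambda>(A, e). (insert e A, e)) ?P" 
    by (rule inj_on_inverseI[where g = "\<lambda>(A, e). (A - {e}, e)"]) auto
  moreover have "(\<lambda>(A, e). (insert e A, e)) ` ?P \<subseteq> ?Q" using finA by (auto simp: card_insert_if)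
  moreover have "finite ?Q" using fG finA by (auto intro!: finite_SigmaI)
  ultimately have "card ?P \<le> card ?Q" by (rule card_inj_on_le)
  also have "card ?Q = (\<Sum>A\<in>?G (Suc i). card A)" using fG finA by (intro card_SigmaI) auto
  also have "\<dots> = (\<Sum>A\<in>?G (Suc i). Suc i)" by (intro sum.cong) auto
  also have "\<dots> = card (?G (Suc i)) * Suc i" by simp
  finally have 1: "real (card ?P) \<le> real (card (?G (Suc i))) * real (Suc i)"
    unfolding of_nat_mult[symmetric] by (rule of_nat_mono)
  have "(real (card E) / 2) ^ i / fact i * (real (card E) / 2) \<le> real (card (?G i)) * (real (card E) / 2)"
    using Suc by (intro mult_right_mono) auto
  also have "\<dots> \<le> (\<Sum>A\<in>?G i. real (card {e \<in> E - A. good (insert e A)}))"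
    using Suc.prems by (intro sum_bounded_below card_good_extensions[OF _ _ m_small]) auto
  also have "\<dots> = real (card ?P)"
    using fG finite_E by (subst card_SigmaI) auto
  finally have "(real (card E) / 2) ^ i / fact i * (real (card E) / 2) \<le> real (card (?G (Suc i))) * real (Suc i)"
    using 1 by linarith
  then have "(real (card E) / 2) ^ i / fact i * (real (card E) / 2) / real (Suc i) \<le> real (card (?G (Suc i)))"
    by (subst pos_divide_le_eq) auto
  also have "(real (card E) / 2) ^ i / fact i * (real (card E) / 2) / real (Suc i)
      = (real (card E) / 2) ^ Suc i / fact (Suc i)"
    by (simp only: fact_Suc of_nat_mult of_nat_fact power_Suc divide_divide_eq_left
        times_divide_eq_left times_divide_eq_right mult_ac)
  finally show ?case .
qed

text \<open>\<open>rprob_avoid_ge\<close> with \<open>W = \<Union>A\<close>. Goodness leaves each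
  other edge a vertex outside \<open>W\<close>, so \<open>c f \<le> p \<le> 1 / 2\<close> and
  \<open>1 - c f \<ge> exp (- 2 * c f)\<close>. The three error terms come from edges meeting
  \<open>W\<close> in zero, one, or at least two vertices.\<close>

lemma rprob_exactly_ge:
  assumes A: "good A" "card A = m" and p: "0 < p" "p \<le> 1 / 2"
  shows "rprob V p (\<lambda>S. {f \<in> E. f \<subseteq> S} = A) \<ge>
    p ^ (k * m) * exp (- 2 * (real (card E) * p ^ k
      + real k * real m * real (card V) * D * p ^ (k - 1) + (real k * real m)\<^sup>2 * D * p))"
proof -
  let ?U = "\<Union>A"
  have AE: "A \<subseteq> E" using A by (simp add: good_def)
  note U = card_Union_edges[OF AE, unfolded A(2)]
  have w: "real (card ?U) \<le> real k * real m" using U(2) unfolding of_nat_mult[symmetric] by (rule of_nat_mono)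
  define c where "c f = p ^ card (f - ?U)" for f
  have c0: "c f \<ge> 0" for f using p by (simp add: c_def)
  have exp_le: "exp (- 2 * c f) \<le> 1 - c f" if f: "f \<in> E - A" for f
  proof -
    have "\<not> f \<subseteq> ?U" using A(1) f by (auto simp: good_def)
    then have "card (f - ?U) \<noteq> 0" using finite_edge f by auto
    then have "c f \<le> p ^ 1" unfolding c_def using p by (intro power_decreasing) auto
    then have c: "c f \<le> 1 / 2" using p by simp
    have "(c f)\<^sup>2 * 2 \<le> c f" using c c0[of f] mult_left_mono[of "c f" "1 / 2" "c f"] by (simp add: power2_eq_square)
    then have "- 2 * c f \<le> - c f - 2 * (c f)\<^sup>2" by simp
    also have "\<dots> \<le> ln (1 - c f)" by (rule ln_one_minus_pos_lower_bound[OF c0 c])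
    finally have "exp (- 2 * c f) \<le> exp (ln (1 - c f))" by simp
    then show ?thesis using c by simp
  qed
  let ?F1 = "{f \<in> E. f \<inter> ?U \<noteq> {}}" and ?F2 = "{f \<in> E. card (f \<inter> ?U) \<ge> 2}"
  have "(\<Sum>f\<in>E - A. c f) \<le> (\<Sum>f\<in>E - A. p ^ k + of_bool (f \<in> ?F1) * p ^ (k - 1) + of_bool (f \<in> ?F2) * p)"
  proof (rule sum_mono)
    fix f assume f: "f \<in> E - A"
    have ff: "finite f" "card f = k" using f finite_edge edge_card by auto
    have cd: "card (f - ?U) = k - card (f \<inter> ?U)" using ff by (simp add: card_Diff_subset_Int)
    have "\<not> f \<subseteq> ?U" using A(1) f by (auto simp: good_def)
    then have pos: "card (f - ?U) \<noteq> 0" using ff by auto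
    consider "card (f \<inter> ?U) = 0" | "card (f \<inter> ?U) = 1" | "card (f \<inter> ?U) \<ge> 2" by linarith
    then show "c f \<le> p ^ k + of_bool (f \<in> ?F1) * p ^ (k - 1) + of_bool (f \<in> ?F2) * p"
    proof cases
      case 1
      then show ?thesis using p cd by (simp add: c_def)
    next
      case 2
      then have "f \<in> ?F1" using f by auto
      then show ?thesis using p cd 2 by (simp add: c_def)
    next
      case 3
      have "c f \<le> p ^ 1" unfolding c_def using p pos by (intro power_decreasing) auto
      then show ?thesis using 3 f p by (simp add: add_nonneg_nonneg add_increasing)
    qed
  qed
  also have "\<dots> \<le> (\<Sum>f\<in>E. p ^ k + of_bool (f \<in> ?F1) * p ^ (k - 1) + of_bool (f \<in> ?F2) * p)"
    using finite_E p by (intro sum_mono2) auto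
  also have "\<dots> = real (card E) * p ^ k + real (card ?F1) * p ^ (k - 1) + real (card ?F2) * p"
    using finite_E by (simp add: sum.distrib sum_of_bool_eq Int_def flip: sum_distrib_right)
  also have "\<dots> \<le> real (card E) * p ^ k
      + (real k * real m * real (card V) * D) * p ^ (k - 1) + ((real k * real m)\<^sup>2 * D) * p"
  proof (intro add_mono mult_right_mono order_refl)
    have "real (card ?F1) \<le> real (card ?U) * (real (card V) * D)" by (rule edges_meeting[OF U(1)])
    also have "\<dots> \<le> (real k * real m) * (real (card V) * D)" using w D1 by (intro mult_right_mono) auto
    finally show "real (card ?F1) \<le> real k * real m * real (card V) * D" by (simp add: mult.assoc)
    have "real (card ?F2) \<le> (real (card ?U))\<^sup>2 * D" by (rule edges_meeting_twice[OF U(1)])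
    also have "\<dots> \<le> (real k * real m)\<^sup>2 * D" using w D1 by (intro mult_right_mono power_mono) auto
    finally show "real (card ?F2) \<le> (real k * real m)\<^sup>2 * D" .
  qed (use p in auto)
  finally have sum: "(\<Sum>f\<in>E - A. c f) \<le> real (card E) * p ^ k
      + real k * real m * real (card V) * D * p ^ (k - 1) + (real k * real m)\<^sup>2 * D * p" by simp
  have "p ^ (k * m) * exp (- 2 * (real (card E) * p ^ k
      + real k * real m * real (card V) * D * p ^ (k - 1) + (real k * real m)\<^sup>2 * D * p))
    \<le> p ^ card ?U * exp (\<Sum>f\<in>E - A. - 2 * c f)"
    unfolding sum_distrib_left[symmetric] using sum U(2) p by (intro mult_mono power_decreasing) auto
  also have "\<dots> = p ^ card ?U * (\<Prod>f\<in>E - A. exp (- 2 * c f))"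
    using finite_E by (simp add: exp_sum)
  also have "\<dots> \<le> p ^ card ?U * (\<Prod>f\<in>E - A. 1 - c f)"
    using p exp_le by (intro mult_left_mono prod_mono) auto
  also have "\<dots> \<le> rprob V p (\<lambda>S. ?U \<subseteq> S \<and> (\<forall>f\<in>E - A. \<not> f \<subseteq> S))"
    unfolding c_def by (rule rprob_avoid_ge) (use finite_V finite_E U edge_subset p in auto)
  also have "\<dots> \<le> rprob V p (\<lambda>S. {f \<in> E. f \<subseteq> S} = A)"
    by (rule rprob_mono) (use AE in auto)
  finally show ?thesis .
qed

text \<open>The events of spanning exactly \<open>A\<close> are disjoint for different
  \<open>A\<close>, so \<open>card_good_sets\<close> and \<open>rprob_exactly_ge\<close> multiply to
  a Poisson-like term times an error factor.\<close>

lemma upper_tail_ge: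
  assumes m_small: "real m + 2 * real k ^ 3 * D\<^sup>2 * (real m)\<^sup>2 * real (card V) \<le> real (card E) / 2"
    and p: "0 < p" "p \<le> 1 / 2" and x: "x \<le> real m" and \<mu>: "\<mu> = real (card E) * p ^ k"
  shows "rprob V p (\<lambda>S. real (card {f \<in> E. f \<subseteq> S}) \<ge> x) \<ge>
    (\<mu> / 2) ^ m / fact m * exp (- 2 * (\<mu>
      + real k * real m * real (card V) * D * p ^ (k - 1) + (real k * real m)\<^sup>2 * D * p))"
proof -
  let ?G = "{A. good A \<and> card A = m}"
  let ?e = "exp (- 2 * (\<mu> + real k * real m * real (card V) * D * p ^ (k - 1) + (real k * real m)\<^sup>2 * D * p))"
  have fG: "finite ?G"
    by (rule finite_subset[of _ "Pow E"]) (auto simp: good_def finite_E)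
  have "(\<mu> / 2) ^ m / fact m * ?e = (real (card E) / 2) ^ m / fact m * (p ^ (k * m) * ?e)"
    by (simp add: \<mu> power_mult_distrib power_divide flip: power_mult)
  also have "\<dots> \<le> real (card ?G) * (p ^ (k * m) * ?e)"
    using p by (intro mult_right_mono card_good_sets[OF m_small]) auto
  also have "\<dots> \<le> (\<Sum>A\<in>?G. rprob V p (\<lambda>S. {f \<in> E. f \<subseteq> S} = A))"
    unfolding \<mu> using p by (intro sum_bounded_below rprob_exactly_ge) auto
  also have "\<dots> = measure_pmf.prob (random_set V p) (\<Union>A\<in>?G. {S. {f \<in> E. f \<subseteq> S} = A})"
    using fG by (intro measure_pmf.finite_measure_finite_Union[symmetric]) (auto simp: disjoint_family_on_def)
  also have "\<dots> \<le> rprob V p (\<lambda>S. real (card {f \<in> E. f \<subseteq> S}) \<ge> x)"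
    using x by (intro measure_pmf.finite_measure_mono) auto
  finally show ?thesis .
qed

end

text \<open>Needed for \<open>m_small\<close>: there \<open>m\<close> is at most of order
  \<open>ln n ^ 2\<close>, so \<open>m ^ 2 * card V\<close> must be compared with
  \<open>n ^ 2\<close>.\<close>

lemma eventually_ln_power4_le:
  fixes c d a :: real
  assumes "a > 0" "d > 0"
  shows "eventually (\<lambda>n::nat. c * ln (d * real n) ^ 4 \<le> a * real n) at_top"
proof -
  have "(\<lambda>n::nat. c * ln (d * real n) ^ 4 / real n) \<longlonglongrightarrow> 0"
    using assms(2) by real_asymp
  then have "eventually (\<lambda>n. c * ln (d * real n) ^ 4 / real n < a) at_top"
    using assms(1) by (rule order_tendstoD)
  then show ?thesis
    using eventually_gt_at_top[of "0 :: nat"] by eventually_elim (simp add: field_simps)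
qed

section \<open>Dense sets and the Poisson regime\<close>

context almost_linear
begin

text \<open>The name refers to a lower bound on the upper tail, as in the next two lemmas.
  Containing \<open>W\<close> suffices and has probability \<open>p ^ card W\<close>.\<close>

lemma lower_tail_dense_set:
  assumes p: "0 < p" "p \<le> 1" and W: "W \<subseteq> V" "real (card W) \<le> w" "real (card {f \<in> E. f \<subseteq> W}) \<ge> x"
  shows "exp (- (w * ln (1 / p))) \<le> rprob V p (\<lambda>S. real (card {f \<in> E. f \<subseteq> S}) \<ge> x)"
proof -
  have l: "ln (1 / p) \<ge> 0" using p by simp
  have "exp (- (w * ln (1 / p))) \<le> exp (- (real (card W) * ln (1 / p)))"
    using W(2) l by (simp add: mult_right_mono del: ln_div)
  also have "- (real (card W) * ln (1 / p)) = real (card W) * ln p" using p by (simp add: ln_div)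
  also have "exp (real (card W) * ln p) = p ^ card W" using p by (simp add: exp_of_nat_mult)
  also have "\<dots> = rprob V p (\<lambda>S. W \<subseteq> S)" using rprob_subset[OF finite_V W(1)] p by simp
  also have "\<dots> \<le> rprob V p (\<lambda>S. real (card {f \<in> E. f \<subseteq> S}) \<ge> x)"
  proof (rule rprob_mono)
    fix S assume "W \<subseteq> S"
    then have "card {f \<in> E. f \<subseteq> W} \<le> card {f \<in> E. f \<subseteq> S}"
      using finite_E by (intro card_mono) auto
    then show "real (card {f \<in> E. f \<subseteq> S}) \<ge> x" using W(3) by linarith
  qed
  finally show ?thesis .
qed

text \<open>Here \<open>e\<close> denotes \<open>max 1 \<epsilon>\<close>. The condition
  \<open>small\<close> gives \<open>m \<le> 4 * l ^ 2\<close>, so any fixed power of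
  \<open>m\<close> is beaten by a power of \<open>p\<close>: the error terms in
  \<open>upper_tail_ge\<close> are at most \<open>C2\<close>, and the Poisson term
  dominates.\<close>

lemma lower_tail_poisson:
  fixes n a p \<epsilon> \<mu> :: real
  defines "C2 \<equiv> 864 * real k * D\<^sup>2 / sqrt a + 4096 * (real k)\<^sup>2 * D"
    and "e \<equiv> max 1 \<epsilon>" and "l \<equiv> ln (1 / p)"
  assumes a: "a > 0" and n: "n \<ge> 1" and V: "real (card V) \<le> D * n" and E: "real (card E) \<ge> a * n\<^sup>2"
    and p: "0 < p" "p \<le> 1" and \<epsilon>: "\<epsilon> > 0" and \<mu>_def: "\<mu> = real (card E) * p ^ k"
    and n_large: "a * n\<^sup>2 \<ge> 2 ^ k" "96 * real k ^ 3 * D ^ 3 * ln (2 * D\<^sup>2 * n) ^ 4 \<le> a * n"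
    and x1: "(1 + \<epsilon>) * \<mu> \<ge> 1" and small: "e ^ 3 * \<mu> \<le> l\<^sup>2"
  shows "exp (- ((34 + 4 * C2) * e\<^sup>2 * \<mu>)) \<le> rprob V p (\<lambda>S. real (card {f \<in> E. f \<subseteq> S}) \<ge> (1 + \<epsilon>) * \<mu>)"
proof -
  define x where "x = (1 + \<epsilon>) * \<mu>"
  define m where "m = nat \<lceil>x\<rceil>"
  define g where "g = sqrt p"
  have sa: "sqrt a > 0" using a by simp
  have k: "real k \<ge> 3" using k3 by simp
  have C2: "C2 \<ge> 0" using sa D1 by (simp add: C2_def)
  have "a * n\<^sup>2 > 0" using a n by simp
  then have \<mu>: "\<mu> > 0" using E p by (auto simp: \<mu>_def)
  have e: "e \<ge> 1" "\<epsilon> \<le> e" by (auto simp: e_def)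
  have l0: "l \<ge> 0" using p by (simp add: l_def)
  have pl: "p = exp (- l)" using p by (simp add: l_def ln_div)
  have x: "x \<ge> 1" "x \<le> 2 * e * \<mu>"
    using x1 e \<mu> by (auto simp: x_def intro!: mult_right_mono)
  have m: "x \<le> real m" "real m \<le> 2 * x" "real m \<ge> 1" using x unfolding m_def by linarith+
  have e23: "e * \<mu> \<le> e ^ 3 * \<mu>" "e\<^sup>2 * \<mu> \<le> e ^ 3 * \<mu>" "\<mu> \<le> e ^ 3 * \<mu>" "e * \<mu> \<le> e\<^sup>2 * \<mu>"
    using e \<mu> power_increasing[of 1 3 e] power_increasing[of 2 3 e] power_increasing[of 1 2 e] one_le_power[of e 3]
    by (auto intro!: mult_right_mono)
  have \<mu>l: "\<mu> \<le> l\<^sup>2" using e23 small by linarith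
  have m_e: "real m \<le> 4 * e * \<mu>" using m x by linarith
  have m_l: "real m \<le> 4 * l\<^sup>2" using m_e e23 small by linarith
  have "e\<^sup>2 * 1 \<le> e\<^sup>2 * (2 * e * \<mu>)" using x e by (intro mult_left_mono) auto
  also have "\<dots> = 2 * (e ^ 3 * \<mu>)" by (simp add: power2_eq_square power3_eq_cube)
  also have "\<dots> \<le> 2 * l\<^sup>2" using small by simp
  also have "\<dots> \<le> (2 * l)\<^sup>2" by (simp add: power_mult_distrib)
  finally have "e\<^sup>2 \<le> (2 * l)\<^sup>2" by simp
  then have el: "e \<le> 2 * l" by (rule power2_le_imp_le) (use l0 in simp)
  then have l_pos: "l > 0" using e by linarith
  have l\<mu>: "1 \<le> 4 * l * \<mu>"
  proof -
    have "2 * e * \<mu> \<le> 2 * (2 * l) * \<mu>" using el \<mu> by (intro mult_right_mono) auto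
    then show ?thesis using x by linarith
  qed
  have cE: "real (card E) \<le> D ^ 3 * n\<^sup>2"
  proof -
    have "E \<subseteq> {f \<in> E. card (f \<inter> V) \<ge> 2}"
    proof
      fix f assume f: "f \<in> E"
      then have "f \<inter> V = f" using edge_subset by blast
      then show "f \<in> {f \<in> E. card (f \<inter> V) \<ge> 2}" using f edge_card k3 by auto
    qed
    then have "real (card E) \<le> real (card {f \<in> E. card (f \<inter> V) \<ge> 2})"
      using finite_E by (auto intro!: card_mono)
    also have "\<dots> \<le> (real (card V))\<^sup>2 * D" by (rule edges_meeting_twice[OF finite_V])
    also have "\<dots> \<le> (D * n)\<^sup>2 * D" using V D1 by (intro mult_right_mono power_mono) auto
    finally show ?thesis by (simp add: power2_eq_square power3_eq_cube mult_ac)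
  qed
  \<comment> \<open>Otherwise \<open>\<mu> \<ge> 1\<close> because
    \<open>a * n ^ 2 \<ge> 2 ^ k\<close>, whereas \<open>\<mu> \<le> l ^ 2 < 1\<close>.\<close>
  have p_half: "p \<le> 1 / 2"
  proof (rule ccontr)
    assume "\<not> p \<le> 1 / 2"
    then have p2: "p > 1 / 2" by simp
    then have "1 / p < 2" using p by (simp add: field_simps)
    then have "l < ln 2" unfolding l_def using p by (subst ln_less_cancel_iff) auto
    then have "l < 1" using ln_2_less_1 by linarith
    then have "l\<^sup>2 < 1" using l_pos by (simp add: power_less_one_iff)
    have "1 = 2 ^ k * (1 / 2 :: real) ^ k" by (simp flip: power_mult_distrib)
    also have "\<dots> \<le> a * n\<^sup>2 * p ^ k" using n_large(1) p2 a by (intro mult_mono power_mono) auto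
    also have "\<dots> \<le> \<mu>" unfolding \<mu>_def using E p by (intro mult_right_mono) auto
    finally show False using \<mu>l \<open>l\<^sup>2 < 1\<close> by linarith
  qed
  \<comment> \<open>Since \<open>\<mu>\<close> is not too small, \<open>p\<close> cannot be much
    below \<open>1 / n\<close>: combining \<open>1 \<le> 4 * l * \<mu>\<close>,
    \<open>l \<le> 1 / p\<close> and \<open>cE\<close> gives
    \<open>1 / p \<le> 2 * D ^ 2 * n\<close>.\<close>
  have l_le: "l \<le> ln (2 * D\<^sup>2 * n)"
  proof -
    have lp: "l \<le> 1 / p"
    proof -
      have "l \<le> exp l" using exp_ge_add_one_self[of l] by linarith
      then show ?thesis by (simp add: pl exp_minus inverse_eq_divide)
    qed
    have "p\<^sup>2 * 1 \<le> p\<^sup>2 * (4 * l * \<mu>)" using l\<mu> by (intro mult_left_mono) auto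
    also have "\<dots> \<le> p\<^sup>2 * (4 * (1 / p) * \<mu>)" using lp \<mu> by (intro mult_left_mono mult_right_mono) auto
    also have "\<dots> = 4 * p * \<mu>" using p by (simp add: power2_eq_square)
    also have "\<dots> \<le> 4 * p * (D ^ 3 * n\<^sup>2 * p ^ k)"
      unfolding \<mu>_def using cE p by (intro mult_left_mono mult_right_mono) auto
    also have "\<dots> \<le> 4 * p * (D ^ 4 * n\<^sup>2 * p ^ 3)"
    proof -
      have "D ^ 3 \<le> D ^ 4" "p ^ k \<le> p ^ 3"
        using p D1 k3 by (auto intro: power_increasing power_decreasing)
      then show ?thesis using p D1 by (intro mult_left_mono mult_mono) auto
    qed
    also have "\<dots> = (2 * D\<^sup>2 * n * p\<^sup>2)\<^sup>2" by (simp add: eval_nat_numeral)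
    finally have "p\<^sup>2 \<le> (2 * D\<^sup>2 * n * p\<^sup>2)\<^sup>2" by simp
    then have "p \<le> 2 * D\<^sup>2 * n * p\<^sup>2" by (rule power2_le_imp_le) (use D1 n in auto)
    then have "1 / p \<le> 2 * D\<^sup>2 * n" using p by (simp add: field_simps power2_eq_square)
    then show ?thesis unfolding l_def using p D1 n by (subst ln_le_cancel_iff) auto
  qed
  have m_small: "real m + 2 * real k ^ 3 * D\<^sup>2 * (real m)\<^sup>2 * real (card V) \<le> real (card E) / 2"
  proof -
    let ?c = "real k ^ 3 * D ^ 3 * (real m)\<^sup>2 * n"
    have "real m * (1 * 1 * 1 * 1) \<le> real m * (real k ^ 3 * D ^ 3 * real m * n)"
      using k D1 m n by (intro mult_left_mono mult_mono) (auto simp: one_le_power)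
    then have 1: "real m \<le> ?c" by (simp add: power2_eq_square mult_ac)
    have "2 * real k ^ 3 * D\<^sup>2 * (real m)\<^sup>2 * real (card V) \<le> 2 * real k ^ 3 * D\<^sup>2 * (real m)\<^sup>2 * (D * n)"
      using V by (intro mult_left_mono) auto
    also have "\<dots> = 2 * ?c" by (simp add: power2_eq_square power3_eq_cube)
    finally have "real m + 2 * real k ^ 3 * D\<^sup>2 * (real m)\<^sup>2 * real (card V) \<le> 3 * ?c"
      using 1 by linarith
    also have "\<dots> \<le> 3 * (real k ^ 3 * D ^ 3 * (4 * ln (2 * D\<^sup>2 * n) ^ 2)\<^sup>2 * n)"
    proof -
      have "l\<^sup>2 \<le> ln (2 * D\<^sup>2 * n) ^ 2" using l_le l_pos by (intro power_mono) auto
      then have "real m \<le> 4 * ln (2 * D\<^sup>2 * n) ^ 2" using m_l by linarith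
      then show ?thesis using D1 n by (intro mult_left_mono mult_right_mono power_mono) auto
    qed
    also have "\<dots> = (96 * real k ^ 3 * D ^ 3 * ln (2 * D\<^sup>2 * n) ^ 4) * n / 2"
      by (simp add: power_mult_distrib flip: power_mult)
    also have "\<dots> \<le> (a * n) * n / 2"
      using n_large(2) n by (intro divide_right_mono mult_right_mono) auto
    also have "\<dots> \<le> real (card E) / 2" using E by (simp add: power2_eq_square)
    finally show ?thesis .
  qed
  have g: "0 < g" "g \<le> 1" "p = g\<^sup>2" "g = exp (- (l / 2))"
  proof -
    show "0 < g" "g \<le> 1" "p = g\<^sup>2" using p by (auto simp: g_def)
    have "(exp (- (l / 2)))\<^sup>2 = p" by (simp add: pl flip: exp_of_nat_mult)
    then show "g = exp (- (l / 2))" unfolding g_def by (intro real_sqrt_unique) auto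
  qed
  have n_le: "n * g ^ k \<le> l / sqrt a"
  proof -
    have "(sqrt a * (n * g ^ k))\<^sup>2 = a * n\<^sup>2 * p ^ k"
      using a by (simp add: power_mult_distrib g(3) mult.commute flip: power_mult)
    also have "\<dots> \<le> \<mu>" unfolding \<mu>_def using E p by (intro mult_right_mono) auto
    finally have "(sqrt a * (n * g ^ k))\<^sup>2 \<le> l\<^sup>2" using \<mu>l by linarith
    then have "sqrt a * (n * g ^ k) \<le> l" using l0 by (rule power2_le_imp_le)
    then show ?thesis using sa by (simp add: field_simps)
  qed
  have lexp: "l \<le> c * exp (l / c)" if "c > 0" for c
    using exp_ge_add_one_self[of "l / c"] that by (simp add: field_simps)
  have l3: "l ^ 3 * g \<le> 216"
  proof -
    have "l ^ 3 \<le> (6 * exp (l / 6)) ^ 3" using lexp[of 6] l0 by (intro power_mono) auto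
    also have "\<dots> = 216 * exp (l / 2)" by (simp add: power_mult_distrib flip: exp_of_nat_mult)
    finally have "l ^ 3 * g \<le> 216 * exp (l / 2) * g" using g by (intro mult_right_mono) auto
    also have "\<dots> = 216" by (simp add: g(4) mult.assoc flip: exp_add)
    finally show ?thesis .
  qed
  have l4: "l ^ 4 * p \<le> 256"
  proof -
    have "l ^ 4 \<le> (4 * exp (l / 4)) ^ 4" using lexp[of 4] l0 by (intro power_mono) auto
    also have "\<dots> = 256 * exp l" by (simp add: power_mult_distrib flip: exp_of_nat_mult)
    finally have "l ^ 4 * p \<le> 256 * exp l * p" using p by (intro mult_right_mono) auto
    also have "\<dots> = 256" by (simp add: pl mult.assoc flip: exp_add)
    finally show ?thesis .
  qed
  have t1: "real k * real m * real (card V) * D * p ^ (k - 1) \<le> 864 * real k * D\<^sup>2 / sqrt a"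
  proof -
    have pk1: "p ^ (k - 1) \<le> g ^ k * g"
    proof -
      have "p ^ (k - 1) = g ^ (2 * (k - 1))" by (simp add: g(3) power_mult)
      also have "\<dots> \<le> g ^ (k + 1)" using g k3 by (intro power_decreasing) auto
      finally show ?thesis by (simp add: mult.commute)
    qed
    have "real k * real m * real (card V) * D * p ^ (k - 1) \<le> real k * (4 * l\<^sup>2) * (D * n) * D * (g ^ k * g)"
      using m_l V D1 n p pk1 g by (intro mult_mono) auto
    also have "\<dots> = 4 * real k * D\<^sup>2 * l\<^sup>2 * g * (n * g ^ k)" by (simp add: power2_eq_square mult_ac)
    also have "\<dots> \<le> 4 * real k * D\<^sup>2 * l\<^sup>2 * g * (l / sqrt a)" using n_le g by (intro mult_left_mono) auto
    also have "\<dots> = 4 * real k * D\<^sup>2 / sqrt a * (l ^ 3 * g)" by (simp add: power2_eq_square power3_eq_cube)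
    also have "\<dots> \<le> 4 * real k * D\<^sup>2 / sqrt a * 216" using l3 a by (intro mult_left_mono) auto
    finally show ?thesis by simp
  qed
  have t2: "(real k * real m)\<^sup>2 * D * p \<le> 4096 * (real k)\<^sup>2 * D"
  proof -
    have "(real k * real m)\<^sup>2 * D * p \<le> (real k * (4 * l\<^sup>2))\<^sup>2 * D * p"
      using m_l D1 p by (intro mult_right_mono power_mono mult_left_mono) auto
    also have "\<dots> = 16 * (real k)\<^sup>2 * D * (l ^ 4 * p)" by (simp add: power_mult_distrib flip: power_mult)
    also have "\<dots> \<le> 16 * (real k)\<^sup>2 * D * 256" using l4 D1 by (intro mult_left_mono) auto
    finally show ?thesis by simp
  qed
  have ex2: "- (2 * e\<^sup>2 * \<mu> + 4 * C2 * e\<^sup>2 * \<mu>) \<le> - 2 * (\<mu>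
      + real k * real m * real (card V) * D * p ^ (k - 1) + (real k * real m)\<^sup>2 * D * p)"
  proof -
    \<comment> \<open>The bounded error is absorbed because \<open>x \<ge> 1\<close> forces
      \<open>1 \<le> 2 * e ^ 2 * \<mu>\<close>.\<close>
    have "C2 * 1 \<le> C2 * (2 * (e\<^sup>2 * \<mu>))" using x e23 C2 by (intro mult_left_mono) auto
    moreover have "real k * real m * real (card V) * D * p ^ (k - 1) + (real k * real m)\<^sup>2 * D * p \<le> C2"
      using t1 t2 by (simp add: C2_def)
    moreover have "\<mu> \<le> e\<^sup>2 * \<mu>" using e \<mu> by (simp add: one_le_power)
    ultimately show ?thesis by (simp add: algebra_simps)
  qed
  \<comment> \<open>Uses \<open>fact m \<le> m ^ m\<close>, then
    \<open>m \<le> 4 * e * \<mu>\<close> to bound the base from below by \<open>1 / (8 * e)\<close>,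
    and finally \<open>8 * e \<le> exp (8 * e)\<close>.\<close>
  have main: "exp (- (32 * e\<^sup>2 * \<mu>)) \<le> (\<mu> / 2) ^ m / fact m"
  proof -
    have "8 * e * m \<le> 8 * e * (4 * e * \<mu>)" using m_e e by (intro mult_left_mono) auto
    then have "- (32 * e\<^sup>2 * \<mu>) \<le> real m * (- (8 * e))" by (simp add: power2_eq_square mult_ac)
    then have "exp (- (32 * e\<^sup>2 * \<mu>)) \<le> exp (real m * (- (8 * e)))" by (simp only: exp_le_cancel_iff)
    also have "\<dots> = (exp (- (8 * e))) ^ m" by (rule exp_of_nat_mult)
    also have "\<dots> \<le> (1 / (8 * e)) ^ m"
    proof -
      have "8 * e \<le> exp (8 * e)" using exp_ge_add_one_self[of "8 * e"] by linarith
      then show ?thesis using e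
        by (intro power_mono) (auto simp: exp_minus inverse_eq_divide intro!: divide_left_mono)
    qed
    also have "\<dots> \<le> (\<mu> / (2 * real m)) ^ m"
      using m_e e m by (intro power_mono) (auto simp: field_simps)
    also have "\<dots> = (\<mu> / 2) ^ m / (real m) ^ m" by (simp add: power_divide power_mult_distrib)
    also have "\<dots> \<le> (\<mu> / 2) ^ m / fact m"
      using \<mu> m fact_le_power[of m, where 'a = real] by (intro divide_left_mono) auto
    finally show ?thesis .
  qed
  have "exp (- ((34 + 4 * C2) * e\<^sup>2 * \<mu>)) = exp (- (32 * e\<^sup>2 * \<mu>)) * exp (- (2 * e\<^sup>2 * \<mu> + 4 * C2 * e\<^sup>2 * \<mu>))"
    by (simp add: algebra_simps flip: exp_add)
  also have "\<dots> \<le> (\<mu> / 2) ^ m / fact m * exp (- 2 * (\<mu>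
      + real k * real m * real (card V) * D * p ^ (k - 1) + (real k * real m)\<^sup>2 * D * p))"
    using main ex2 \<mu> by (intro mult_mono) auto
  also have "\<dots> \<le> rprob V p (\<lambda>S. real (card {f \<in> E. f \<subseteq> S}) \<ge> x)"
    by (rule upper_tail_ge[OF m_small p(1) p_half m(1) \<mu>_def])
  finally show ?thesis by (simp add: x_def)
qed

text \<open>The dense set serves when \<open>sqrt \<mu> * l\<close> is the minimum, and also when
  \<open>l ^ 2 < e ^ 3 * \<mu>\<close>, since then its cost \<open>w * l\<close> is at most
  \<open>2 * D * e ^ 2 * \<mu>\<close>. The threshold \<open>e ^ 3\<close> is chosen so that
  \<open>sqrt e * sqrt (e ^ 3) = e ^ 2\<close>. In the remaining range
  \<open>lower_tail_poisson\<close> applies.\<close>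

lemma lower_tail_bound:
  fixes n a p \<epsilon> \<mu> :: real
  defines "C2 \<equiv> 864 * real k * D\<^sup>2 / sqrt a + 4096 * (real k)\<^sup>2 * D"
  assumes a: "a > 0" and n: "n \<ge> 1" and V: "real (card V) \<le> D * n" and E: "real (card E) \<ge> a * n\<^sup>2"
    and p: "0 < p" "p \<le> 1" and \<epsilon>: "\<epsilon> > 0" and \<mu>_def: "\<mu> = real (card E) * p ^ k"
    and n_large: "a * n\<^sup>2 \<ge> 2 ^ k" "96 * real k ^ 3 * D ^ 3 * ln (2 * D\<^sup>2 * n) ^ 4 \<le> a * n"
    and x1: "(1 + \<epsilon>) * \<mu> \<ge> 1"
    and W: "W \<subseteq> V" "real (card W) \<le> D * max (sqrt ((1 + \<epsilon>) * \<mu>)) 1"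
      "real (card {f \<in> E. f \<subseteq> W}) \<ge> (1 + \<epsilon>) * \<mu>"
  shows "exp (- ((2 * D + 34 + 4 * C2) * max 1 (\<epsilon>\<^sup>2) * min \<mu> (sqrt \<mu> * ln (1 / p))))
    \<le> rprob V p (\<lambda>S. real (card {f \<in> E. f \<subseteq> S}) \<ge> (1 + \<epsilon>) * \<mu>)" (is "?L \<le> ?R")
proof -
  define e where "e = max 1 \<epsilon>"
  define l where "l = ln (1 / p)"
  define B where "B = 2 * D + 34 + 4 * C2"
  have e: "e \<ge> 1" "\<epsilon> \<le> e" "max 1 (\<epsilon>\<^sup>2) = e\<^sup>2"
  proof -
    show "e \<ge> 1" "\<epsilon> \<le> e" by (auto simp: e_def)
    show "max 1 (\<epsilon>\<^sup>2) = e\<^sup>2"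
      using \<epsilon> power_le_one[of \<epsilon> 2] one_le_power[of \<epsilon> 2] by (cases "\<epsilon> \<le> 1") (auto simp: e_def)
  qed
  have l0: "l \<ge> 0" using p by (simp add: l_def)
  have C2: "C2 \<ge> 0" using a D1 by (simp add: C2_def)
  have "a * n\<^sup>2 > 0" using a n by simp
  then have \<mu>: "\<mu> > 0" using E p by (auto simp: \<mu>_def)
  have B: "B \<ge> 2 * D" "B \<ge> 34 + 4 * C2" using C2 D1 by (auto simp: B_def)
  define w where "w = D * sqrt ((1 + \<epsilon>) * \<mu>)"
  have "max (sqrt ((1 + \<epsilon>) * \<mu>)) 1 = sqrt ((1 + \<epsilon>) * \<mu>)" using x1 by simp
  with W(2) have "real (card W) \<le> w" by (simp add: w_def)
  from lower_tail_dense_set[OF p W(1) this W(3)] have R: "exp (- (w * l)) \<le> ?R" by (simp add: l_def)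
  have w: "w \<le> 2 * D * sqrt e * sqrt \<mu>"
  proof -
    have "sqrt ((1 + \<epsilon>) * \<mu>) \<le> sqrt (4 * (e * \<mu>))"
      using e \<mu> by (intro real_sqrt_le_mono) (auto simp flip: mult.assoc intro!: mult_right_mono)
    also have "\<dots> = 2 * (sqrt e * sqrt \<mu>)" by (simp add: real_sqrt_mult)
    finally show ?thesis using D1 by (simp add: w_def mult.assoc)
  qed
  have se: "sqrt e \<le> e\<^sup>2"
  proof (rule real_le_lsqrt)
    show "e \<le> (e\<^sup>2)\<^sup>2" using power_increasing[of 1 4 e] e by (simp flip: power_mult)
  qed (use e in auto)
  have case1: "w * l \<le> B * e\<^sup>2 * (sqrt \<mu> * l)"
  proof -
    have "2 * D * sqrt e \<le> B * e\<^sup>2" using se B D1 e by (intro mult_mono) auto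
    then have "2 * D * sqrt e * sqrt \<mu> \<le> B * e\<^sup>2 * sqrt \<mu>" using \<mu> by (intro mult_right_mono) auto
    with w have "w \<le> B * e\<^sup>2 * sqrt \<mu>" by linarith
    then show ?thesis using l0 mult_right_mono[of w "B * e\<^sup>2 * sqrt \<mu>" l] by (simp add: mult.assoc)
  qed
  have "?L = exp (- (B * e\<^sup>2 * min \<mu> (sqrt \<mu> * l)))" by (simp add: B_def e(3) l_def)
  also have "\<dots> \<le> ?R"
  proof (cases "sqrt \<mu> * l \<le> \<mu>")
    case True
    then have "min \<mu> (sqrt \<mu> * l) = sqrt \<mu> * l" by simp
    moreover have "exp (- (B * e\<^sup>2 * (sqrt \<mu> * l))) \<le> exp (- (w * l))" using case1 by simp
    from this R have "exp (- (B * e\<^sup>2 * (sqrt \<mu> * l))) \<le> ?R" by (rule order_trans)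
    ultimately show ?thesis by (simp only:)
  next
    case False
    then have min: "min \<mu> (sqrt \<mu> * l) = \<mu>" by simp
    show ?thesis
    proof (cases "e ^ 3 * \<mu> \<le> l\<^sup>2")
      case True
      have "(34 + 4 * C2) * e\<^sup>2 * \<mu> \<le> B * e\<^sup>2 * \<mu>" using B \<mu> by (intro mult_right_mono) auto
      then have "exp (- (B * e\<^sup>2 * \<mu>)) \<le> exp (- ((34 + 4 * C2) * e\<^sup>2 * \<mu>))" by simp
      also have "\<dots> \<le> ?R"
        unfolding C2_def e_def
        by (rule lower_tail_poisson[OF a n V E p \<epsilon> \<mu>_def n_large x1 True[unfolded e_def l_def]])
      finally show ?thesis by (simp only: min)
    next
      case False
      then have "sqrt (l\<^sup>2) \<le> sqrt (e ^ 3 * \<mu>)" by (intro real_sqrt_le_mono) simp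
      then have "l \<le> sqrt (e ^ 3) * sqrt \<mu>" using l0 by (simp add: real_sqrt_mult)
      then have "w * l \<le> (2 * D * sqrt e * sqrt \<mu>) * (sqrt (e ^ 3) * sqrt \<mu>)"
        using w l0 D1 e \<mu> by (intro mult_mono) auto
      also have "\<dots> = 2 * D * (sqrt e * sqrt (e ^ 3)) * (sqrt \<mu> * sqrt \<mu>)" by (simp add: mult_ac)
      also have "sqrt e * sqrt (e ^ 3) = e\<^sup>2"
      proof -
        have "sqrt e * sqrt (e ^ 3) = sqrt (e * e ^ 3)" by (simp only: real_sqrt_mult)
        also have "e * e ^ 3 = (e\<^sup>2)\<^sup>2" by (simp add: eval_nat_numeral)
        also have "sqrt ((e\<^sup>2)\<^sup>2) = e\<^sup>2" by (rule real_sqrt_unique) simp_all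
        finally show ?thesis .
      qed
      also have "2 * D * e\<^sup>2 * (sqrt \<mu> * sqrt \<mu>) \<le> B * e\<^sup>2 * \<mu>"
        using B \<mu> by (auto intro!: mult_right_mono)
      finally have "exp (- (B * e\<^sup>2 * \<mu>)) \<le> exp (- (w * l))" by simp
      from this R have "exp (- (B * e\<^sup>2 * \<mu>)) \<le> ?R" by (rule order_trans)
      then show ?thesis by (simp only: min)
    qed
  qed
  finally show ?thesis .
qed

end

section \<open>Translation from the hypergraph definitions\<close>

lemma almost_linear_hypergraph:
  assumes H: "uniform_hypergraph k H" and "k \<ge> 3" "D \<ge> 1" and cd: "real (max_codegree 2 H) \<le> D"
  shows "almost_linear (hverts H) (hedges H) k D"
proof
  show fin: "finite (hverts H)" using H by (simp add: uniform_hypergraph_def hypergraph_def)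
  show sub: "f \<subseteq> hverts H" and "card f = k" if "f \<in> hedges H" for f
    using H that by (auto simp: uniform_hypergraph_def hypergraph_def)
  \<comment> \<open>If both are vertices of \<open>H\<close>, then \<open>{u, v}\<close> takes part
    in the maximum; otherwise no edge contains both.\<close>
  show "real (card {f \<in> hedges H. u \<in> f \<and> v \<in> f}) \<le> D" if uv: "u \<noteq> v" for u v
  proof (cases "u \<in> hverts H \<and> v \<in> hverts H")
    case True
    let ?c = "\<lambda>S. card {f \<in> hedges H. S \<subseteq> f}"
    have "?c {u, v} \<le> max_codegree 2 H"
      unfolding max_codegree_def using fin True uv
      by (intro Max_ge finite_imageI imageI) (auto intro: finite_subset[of _ "Pow (hverts H)"])
    then show ?thesis using cd by simp
  next
    case False
    then have "{f \<in> hedges H. u \<in> f \<and> v \<in> f} = {}" using sub by blast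
    then show ?thesis using assms(3) by (simp only: card.empty)
  qed
qed (use assms in auto)

lemma num_edges_induced: "num_edges (induced_subhypergraph H S) = card {f \<in> hedges H. f \<subseteq> S}"
  by (simp add: num_edges_def induced_subhypergraph_def hedges_def)

lemma random_subhypergraph_prob:
  "measure_pmf.prob (random_subhypergraph H p) {G. real (num_edges G) \<ge> x}
    = rprob (hverts H) p (\<lambda>S. real (card {f \<in> hedges H. f \<subseteq> S}) \<ge> x)"
  by (simp add: random_subhypergraph_def random_vertex_set_def vimage_def num_edges_induced flip: random_set_def)

lemma expected_edges_eq:
  "expected_edges H p = measure_pmf.expectation (random_set (hverts H) p) (\<lambda>S. real (card {f \<in> hedges H. f \<subseteq> S}))"
  by (simp add: expected_edges_def random_subhypergraph_def random_vertex_set_def num_edges_induced flip: random_set_def)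

theorem theorem1p4:
  fixes k :: nat and a D :: real
  assumes "k \<ge> 3" and "a > 0" and "D \<ge> 1"
  shows "\<exists>(n0::nat) (b::real) (B::real). n0 > 0 \<and> b > 0 \<and> B > 0 \<and>
    (\<forall>(n::nat) (H :: 'v hypergraph) (p::real) (\<epsilon>::real).
       n \<ge> n0 \<longrightarrow> uniform_hypergraph k H \<longrightarrow>
       real (num_verts H) \<le> D * real n \<longrightarrow>
       real (num_edges H) \<ge> a * (real n)\<^sup>2 \<longrightarrow>
       real (max_codegree 2 H) \<le> D \<longrightarrow>
       0 < p \<longrightarrow> p \<le> 1 \<longrightarrow> \<epsilon> > 0 \<longrightarrow>
       (let \<mu> = expected_edges H p;
            upper_tail = measure_pmf.prob (random_subhypergraph H p)
                           {G. real (num_edges G) \<ge> (1 + \<epsilon>) * \<mu>};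
            c = b * min (\<epsilon> ^ 3) (\<epsilon> powr (1/2));
            C = B * max 1 (\<epsilon>\<^sup>2)
        in upper_tail \<le> exp (- c * min \<mu> (sqrt \<mu> * ln (exp 1 / p))) \<and>
           (small_dense_set H D ((1 + \<epsilon>) * \<mu>) \<and> (1 + \<epsilon>) * \<mu> \<ge> 1 \<longrightarrow>
              upper_tail \<ge> exp (- C * min \<mu> (sqrt \<mu> * ln (1 / p))))))"
proof -
  define K where "K = 1 + 36 * (D\<^sup>2 / sqrt a + D) + 8 * (D / sqrt a + real k + 1)"
  define b where "b = 1 / (512 * (real k)\<^sup>2 * D * K)"
  define C2 where "C2 = 864 * real k * D\<^sup>2 / sqrt a + 4096 * (real k)\<^sup>2 * D"
  define B where "B = 2 * D + 34 + 4 * C2"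
  have "K > 0" using assms by (auto simp: K_def intro!: add_pos_nonneg)
  then have b: "b > 0" using assms by (simp add: b_def)
  have "C2 \<ge> 0" using assms by (simp add: C2_def)
  then have B: "B > 0" using assms by (simp add: B_def)
  have "eventually (\<lambda>n::nat. a * (real n)\<^sup>2 \<ge> 2 ^ k) at_top"
    using assms(2) by real_asymp
  moreover have "eventually (\<lambda>n::nat. 96 * real k ^ 3 * D ^ 3 * ln (2 * D\<^sup>2 * real n) ^ 4 \<le> a * real n) at_top"
    using assms by (intro eventually_ln_power4_le) auto
  ultimately have "eventually (\<lambda>n::nat. a * (real n)\<^sup>2 \<ge> 2 ^ k \<and>
      96 * real k ^ 3 * D ^ 3 * ln (2 * D\<^sup>2 * real n) ^ 4 \<le> a * real n) at_top"
    by eventually_elim auto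
  then obtain n1 where n1: "\<And>n. n \<ge> n1 \<Longrightarrow> a * (real n)\<^sup>2 \<ge> 2 ^ k"
      "\<And>n. n \<ge> n1 \<Longrightarrow> 96 * real k ^ 3 * D ^ 3 * ln (2 * D\<^sup>2 * real n) ^ 4 \<le> a * real n"
    by (auto simp: eventually_at_top_linorder)
  show ?thesis
  \<comment> \<open>The maximum with 1 makes \<open>n0\<close> positive and provides
    \<open>n \<ge> 1\<close>.\<close>
  proof (rule exI[of _ "max n1 1"], rule exI[of _ b], rule exI[of _ B], intro conjI allI impI)
    fix n :: nat and H :: "'v hypergraph" and p \<epsilon> :: real
    assume n: "max n1 1 \<le> n" and H: "uniform_hypergraph k H" and V: "real (num_verts H) \<le> D * real n"
      and E: "a * (real n)\<^sup>2 \<le> real (num_edges H)" and cd: "real (max_codegree 2 H) \<le> D"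
      and p: "0 < p" "p \<le> 1" and \<epsilon>: "0 < \<epsilon>"
    interpret almost_linear "hverts H" "hedges H" k D
      using almost_linear_hypergraph[OF H assms(1,3) cd] .
    define \<mu> where "\<mu> = real (card (hedges H)) * p ^ k"
    have \<mu>: "expected_edges H p = \<mu>"
      unfolding expected_edges_eq \<mu>_def using p by (intro expectation_edges) auto
    have n': "real n > 0" "real n \<ge> 1" "n \<ge> n1" using n by auto
    note VE = V[unfolded num_verts_def] E[unfolded num_edges_def]
    let ?R = "rprob (hverts H) p (\<lambda>S. real (card {f \<in> hedges H. f \<subseteq> S}) \<ge> (1 + \<epsilon>) * \<mu>)"
    have "?R \<le> exp (- (b * min (\<epsilon> ^ 3) (\<epsilon> powr (1/2)) * min \<mu> (sqrt \<mu> * ln (exp 1 / p))))"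
      using upper_tail_bound[OF assms(2) n'(1) VE p \<epsilon> \<mu>_def] unfolding b_def K_def .
    moreover have "exp (- (B * max 1 (\<epsilon>\<^sup>2) * min \<mu> (sqrt \<mu> * ln (1 / p)))) \<le> ?R"
      if sd: "small_dense_set H D ((1 + \<epsilon>) * \<mu>)" and x: "(1 + \<epsilon>) * \<mu> \<ge> 1"
    proof -
      obtain W where W: "W \<subseteq> hverts H" "real (card W) \<le> D * max (sqrt ((1 + \<epsilon>) * \<mu>)) 1"
          "real (card {f \<in> hedges H. f \<subseteq> W}) \<ge> (1 + \<epsilon>) * \<mu>"
        using sd unfolding small_dense_set_def num_edges_induced by blast
      show ?thesis
        using lower_tail_bound[OF assms(2) n'(2) VE p \<epsilon> \<mu>_def n1(1)[OF n'(3)] n1(2)[OF n'(3)] x W]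
        unfolding B_def C2_def .
    qed
    ultimately show "let \<mu> = expected_edges H p;
            upper_tail = measure_pmf.prob (random_subhypergraph H p)
                           {G. real (num_edges G) \<ge> (1 + \<epsilon>) * \<mu>};
            c = b * min (\<epsilon> ^ 3) (\<epsilon> powr (1/2));
            C = B * max 1 (\<epsilon>\<^sup>2)
        in upper_tail \<le> exp (- c * min \<mu> (sqrt \<mu> * ln (exp 1 / p))) \<and>
           (small_dense_set H D ((1 + \<epsilon>) * \<mu>) \<and> (1 + \<epsilon>) * \<mu> \<ge> 1 \<longrightarrow>
              upper_tail \<ge> exp (- C * min \<mu> (sqrt \<mu> * ln (1 / p))))"
      by (simp add: Let_def \<mu> random_subhypergraph_prob)
  qed (use b B in auto)
qed

end
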